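(* Let $k\ge 1$ and let $\mathbf{w}=(w_1,\dots,w_k)$, where each $w_i$ is a (possibly empty) positive word on the letters $a_1,\dots,a_{i-1}$. Let $$G_k(\mathbf{w})=\langle a_1,\dots,a_k,t\mid a_i^t=a_iw_i,\ 1\le i\le k\rangle$$ and let $H_k=\langle a_1t,\dots,a_kt\rangle\le G_k(\mathbf{w})$. Then $H_k$ is a separable subgroup of $G_k(\mathbf{w})$ if and only if $\mathbf{w}=(1,\dots,1)$. Therefore the HNN extension $$\Gamma_k(\mathbf{w})=\langle G_k(\mathbf{w}),p\mid h^p=h,\ h\in H_k\rangle$$ is residually finite only if $G_k(\mathbf{w})=F_k\times\mathbb{Z}$ (that is, $\mathbf{w}=(1,\dots,1)$, with $F_k=\langle a_1,\dots,a_k\rangle$ free of rank $k$ and $\mathbb{Z}=\langle t\rangle$).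
   Context: Convention: $a^b:=b^{-1}ab$. A positive word is a word with no inverse letters; $1$ denotes the empty word (so $w_1=1$ always). A subgroup $H\le G$ is separable in $G$ if for every $g\in G\setminus H$ there is a homomorphism $\phi$ from $G$ onto a finite group with $\phi(g)\notin\phi(H)$. A group $G$ is residually finite if every non-trivial element has non-trivial image in some finite quotient of $G$. *)

theory Defs
  imports "HOL-Algebra.Elementary_Groups"
begin

section \<open>Group presentations\<close>

datatype 'x letter = Pos 'x | Neg 'x

type_synonym 'x gword = "'x letter list"

definition gwords :: "'x set \<Rightarrow> 'x gword set"
  where "gwords X = lists (Pos ` X \<union> Neg ` X)"

text \<open>
  The smallest congruence on the monoid of words over X and its formal inverses
  that makes \<^term>\<open>Neg x\<close> inverse to \<^term>\<open>Pos x\<close> and identifies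
  the two sides of every relation in R. A relation u = v is the pair (u, v).
\<close>

inductive_set pres_cong :: "'x set \<Rightarrow> ('x gword \<times> 'x gword) set \<Rightarrow> ('x gword \<times> 'x gword) set"
  for X R where
    refl: "u \<in> gwords X \<Longrightarrow> (u, u) \<in> pres_cong X R"
  | sym: "(u, v) \<in> pres_cong X R \<Longrightarrow> (v, u) \<in> pres_cong X R"
  | trans: "(u, v) \<in> pres_cong X R \<Longrightarrow> (v, z) \<in> pres_cong X R \<Longrightarrow> (u, z) \<in> pres_cong X R"
  | append: "(u, v) \<in> pres_cong X R \<Longrightarrow> (u', v') \<in> pres_cong X R
      \<Longrightarrow> (u @ u', v @ v') \<in> pres_cong X R"
  | cancel_right: "x \<in> X \<Longrightarrow> ([Pos x, Neg x], []) \<in> pres_cong X R"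
  | cancel_left: "x \<in> X \<Longrightarrow> ([Neg x, Pos x], []) \<in> pres_cong X R"
  | rel: "(u, v) \<in> R \<Longrightarrow> u \<in> gwords X \<Longrightarrow> v \<in> gwords X \<Longrightarrow> (u, v) \<in> pres_cong X R"

definition pres_class :: "'x set \<Rightarrow> ('x gword \<times> 'x gword) set \<Rightarrow> 'x gword \<Rightarrow> 'x gword set"
  where "pres_class X R u = pres_cong X R `` {u}"

definition presented_group :: "'x set \<Rightarrow> ('x gword \<times> 'x gword) set \<Rightarrow> 'x gword set monoid"
  where "presented_group X R =
    \<lparr>carrier = gwords X // pres_cong X R,
     monoid.mult = (\<lambda>A B. \<Union>u\<in>A. \<Union>v\<in>B. pres_class X R (u @ v)),
     one = pres_class X R []\<rparr>"

abbreviation free_group :: "'x set \<Rightarrow> 'x gword set monoid"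
  where "free_group X \<equiv> presented_group X {}"

lemma pres_cong_gwords:
  assumes "(u, v) \<in> pres_cong X R"
  shows "u \<in> gwords X \<and> v \<in> gwords X"
  using assms by induction (auto simp: gwords_def)

lemma equiv_pres_cong: "equiv (gwords X) (pres_cong X R)"
proof (rule equivI)
  show "pres_cong X R \<subseteq> gwords X \<times> gwords X"
    by (auto dest: pres_cong_gwords)
  show "refl_on (gwords X) (pres_cong X R)"
    by (auto simp: refl_on_def intro: pres_cong.refl)
  show "sym (pres_cong X R)"
    by (rule symI) (rule pres_cong.sym)
  show "trans (pres_cong X R)"
    by (rule transI) (rule pres_cong.trans)
qed

lemma carrier_presented_group:
  "carrier (presented_group X R) = pres_class X R ` gwords X"
  by (auto simp: presented_group_def pres_class_def quotient_def)

lemma one_presented_group: "\<one>\<^bsub>presented_group X R\<^esub> = pres_class X R []"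
  by (simp add: presented_group_def)

lemma pres_class_eq_iff:
  assumes "u \<in> gwords X" "v \<in> gwords X"
  shows "pres_class X R u = pres_class X R v \<longleftrightarrow> (u, v) \<in> pres_cong X R"
  unfolding pres_class_def using eq_equiv_class_iff[OF equiv_pres_cong assms] .

lemma mult_presented_group:
  assumes "u \<in> gwords X" "v \<in> gwords X"
  shows "pres_class X R u \<otimes>\<^bsub>presented_group X R\<^esub> pres_class X R v = pres_class X R (u @ v)"
proof -
  have "pres_class X R (u' @ v') = pres_class X R (u @ v)"
    if "u' \<in> pres_class X R u" "v' \<in> pres_class X R v" for u' v'
  proof -
    have cong: "(u @ v, u' @ v') \<in> pres_cong X R"
      using that by (simp add: pres_class_def pres_cong.append)
    then have "u @ v \<in> gwords X" "u' @ v' \<in> gwords X"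
      using pres_cong_gwords by blast+
    then show ?thesis
      using pres_class_eq_iff cong by metis
  qed
  moreover have "u \<in> pres_class X R u" "v \<in> pres_class X R v"
    using assms by (auto simp: pres_class_def intro: pres_cong.refl)
  ultimately have "(\<Union>u'\<in>pres_class X R u. \<Union>v'\<in>pres_class X R v. pres_class X R (u' @ v'))
      = pres_class X R (u @ v)"
    by blast
  then show ?thesis
    by (simp add: presented_group_def)
qed

lemma pres_cong_left_inverse:
  assumes "u \<in> gwords X"
  shows "\<exists>v\<in>gwords X. (v @ u, []) \<in> pres_cong X R"
  using assms
proof (induction u)
  case Nil
  then show ?case by (auto intro!: bexI[of _ "[]"] pres_cong.refl)
next
  case (Cons l u)
  then have u: "u \<in> gwords X" and l: "l \<in> Pos ` X \<union> Neg ` X"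
    by (auto simp: gwords_def)
  obtain v where v: "v \<in> gwords X" "(v @ u, []) \<in> pres_cong X R"
    using Cons.IH u by blast
  obtain m where m: "[m] \<in> gwords X" "([m, l], []) \<in> pres_cong X R"
    using l by (auto simp: gwords_def intro: pres_cong.cancel_left pres_cong.cancel_right)
  have "(v @ [m, l] @ u, v @ [] @ u) \<in> pres_cong X R"
    by (intro pres_cong.append pres_cong.refl v u m)
  then have "((v @ [m]) @ l # u, []) \<in> pres_cong X R"
    using pres_cong.trans[OF _ v(2), of "v @ [m, l] @ u"] by simp
  moreover have "v @ [m] \<in> gwords X" using v m by (auto simp: gwords_def)
  ultimately show ?case by blast
qed

lemma group_presented_group: "group (presented_group X R)"
proof (rule groupI)
  have app: "u @ v \<in> gwords X" if "u \<in> gwords X" "v \<in> gwords X" for u v :: "'a gword"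
    using that by (auto simp: gwords_def)
  have nil: "[] \<in> gwords X" by (auto simp: gwords_def)
  fix x assume x: "x \<in> carrier (presented_group X R)"
  then obtain u where u: "u \<in> gwords X" "x = pres_class X R u"
    by (auto simp: carrier_presented_group)
  show "\<one>\<^bsub>presented_group X R\<^esub> \<otimes>\<^bsub>presented_group X R\<^esub> x = x"
    using u nil by (simp add: one_presented_group mult_presented_group)
  obtain v where v: "v \<in> gwords X" "(v @ u, []) \<in> pres_cong X R"
    using pres_cong_left_inverse[OF u(1)] by blast
  then have "pres_class X R v \<otimes>\<^bsub>presented_group X R\<^esub> x = \<one>\<^bsub>presented_group X R\<^esub>"
    using u nil app by (simp add: one_presented_group mult_presented_group pres_class_eq_iff)
  then show "\<exists>y\<in>carrier (presented_group X R).
      y \<otimes>\<^bsub>presented_group X R\<^esub> x = \<one>\<^bsub>presented_group X R\<^esub>"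
    using v by (auto simp: carrier_presented_group)
  fix y assume "y \<in> carrier (presented_group X R)"
  then obtain v where v: "v \<in> gwords X" "y = pres_class X R v"
    by (auto simp: carrier_presented_group)
  show "x \<otimes>\<^bsub>presented_group X R\<^esub> y \<in> carrier (presented_group X R)"
    using u v app by (auto simp: mult_presented_group carrier_presented_group)
  fix z assume "z \<in> carrier (presented_group X R)"
  then obtain t where t: "t \<in> gwords X" "z = pres_class X R t"
    by (auto simp: carrier_presented_group)
  show "x \<otimes>\<^bsub>presented_group X R\<^esub> y \<otimes>\<^bsub>presented_group X R\<^esub> z
      = x \<otimes>\<^bsub>presented_group X R\<^esub> (y \<otimes>\<^bsub>presented_group X R\<^esub> z)"
    using u v t app by (simp add: mult_presented_group)
next
  show "\<one>\<^bsub>presented_group X R\<^esub> \<in> carrier (presented_group X R)"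
    by (auto simp: one_presented_group carrier_presented_group gwords_def)
qed

section \<open>HNN extensions\<close>

text \<open>
  The HNN extension with base G, associated subgroups A and \<^term>\<open>f ` A\<close>, and
  stable letter p acting by \<open>a\<^sup>p = p\<^sup>-\<^sup>1 a p = f a\<close>. The base group enters through its
  multiplication table.
\<close>

datatype 'g hnn_gen = Base 'g | Stable

definition hnn_extension ::
    "('g, 'm) monoid_scheme \<Rightarrow> 'g set \<Rightarrow> ('g \<Rightarrow> 'g) \<Rightarrow> 'g hnn_gen gword set monoid"
  where "hnn_extension G A f =
    presented_group (Base ` carrier G \<union> {Stable})
      ({([Pos (Base g), Pos (Base h)], [Pos (Base (g \<otimes>\<^bsub>G\<^esub> h))]) | g h.
          g \<in> carrier G \<and> h \<in> carrier G} \<union>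
       {([Neg Stable, Pos (Base a), Pos Stable], [Pos (Base (f a))]) | a. a \<in> A})"

section \<open>Separability and residual finiteness\<close>

text \<open>
  Finite groups are taken with carrier a set of natural numbers. This is no restriction,
  since every finite group is isomorphic to one of these; see \<open>finite_quotient_nat\<close>.
\<close>

definition separable_subgroup :: "('a, 'm) monoid_scheme \<Rightarrow> 'a set \<Rightarrow> bool"
  where "separable_subgroup G H \<longleftrightarrow> subgroup H G \<and>
    (\<forall>g \<in> carrier G - H. \<exists>(Q :: nat monoid) \<phi>.
       group Q \<and> finite (carrier Q) \<and> \<phi> \<in> epi G Q \<and> \<phi> g \<notin> \<phi> ` H)"

definition residually_finite :: "('a, 'm) monoid_scheme \<Rightarrow> bool"
  where "residually_finite G \<longleftrightarrow>
    (\<forall>g \<in> carrier G - {\<one>\<^bsub>G\<^esub>}. \<exists>(Q :: nat monoid) \<phi>.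
       group Q \<and> finite (carrier Q) \<and> \<phi> \<in> epi G Q \<and> \<phi> g \<noteq> \<one>\<^bsub>Q\<^esub>)"

lemma finite_quotient_nat:
  fixes Q :: "('b, 'n) monoid_scheme"
  assumes Q: "group Q" "finite (carrier Q)" and \<phi>: "\<phi> \<in> epi G Q"
  shows "\<exists>(Q' :: nat monoid) \<psi>. group Q' \<and> finite (carrier Q') \<and> \<psi> \<in> epi G Q' \<and>
    (\<forall>x \<in> carrier G. \<forall>y \<in> carrier G. \<psi> x = \<psi> y \<longleftrightarrow> \<phi> x = \<phi> y)"
proof -
  interpret Q: group Q by fact
  obtain f :: "'b \<Rightarrow> nat" where f: "inj_on f (carrier Q)"
    using finite_imp_inj_to_nat_seg[OF Q(2)] by blast
  define g where "g = the_inv_into (carrier Q) f"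
  have gf [simp]: "g (f x) = x" if "x \<in> carrier Q" for x
    using the_inv_into_f_f[OF f that] by (simp add: g_def)
  define Q' :: "nat monoid" where
    "Q' = \<lparr>carrier = f ` carrier Q, monoid.mult = (\<lambda>x y. f (g x \<otimes>\<^bsub>Q\<^esub> g y)), one = f \<one>\<^bsub>Q\<^esub>\<rparr>"
  have "group Q'"
  proof (rule groupI)
    fix x assume "x \<in> carrier Q'"
    then obtain a where a: "a \<in> carrier Q" "x = f a" by (auto simp: Q'_def)
    then show "\<exists>y\<in>carrier Q'. y \<otimes>\<^bsub>Q'\<^esub> x = \<one>\<^bsub>Q'\<^esub>"
      by (auto simp: Q'_def intro!: bexI[of _ "inv\<^bsub>Q\<^esub> a"])
  qed (auto simp: Q'_def Q.m_assoc)
  moreover have "finite (carrier Q')" using Q by (simp add: Q'_def)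
  moreover have "f \<circ> \<phi> \<in> epi G Q'"
  proof -
    have "f ` \<phi> ` carrier G = carrier Q'" using \<phi> by (simp add: epi_def Q'_def)
    then show ?thesis
      using \<phi> by (simp add: epi_def hom_def Q'_def Pi_iff image_comp)
  qed
  moreover have "(f \<circ> \<phi>) x = (f \<circ> \<phi>) y \<longleftrightarrow> \<phi> x = \<phi> y"
    if "x \<in> carrier G" "y \<in> carrier G" for x y
    using \<phi> that f by (auto simp: epi_def hom_def Pi_iff inj_on_def)
  ultimately show ?thesis by blast
qed

section \<open>The groups of the theorem\<close>

datatype gk_gen = A nat | T

definition Gk_gens :: "nat \<Rightarrow> gk_gen set"
  where "Gk_gens k = A ` {1..k} \<union> {T}"

text \<open>
  A positive word on \<open>a\<^sub>1, a\<^sub>2, \<dots>\<close> is encoded by the list of its indices, and only the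
  values \<open>w 1, \<dots>, w k\<close> of the sequence of words are used. Since conjugation is
  \<open>a\<^sup>b = b\<^sup>-\<^sup>1 a b\<close>, the relation for i reads \<open>t\<^sup>-\<^sup>1 a\<^sub>i t = a\<^sub>i w\<^sub>i\<close>.
\<close>

definition Gk_rels :: "nat \<Rightarrow> (nat \<Rightarrow> nat list) \<Rightarrow> (gk_gen gword \<times> gk_gen gword) set"
  where "Gk_rels k w =
    {([Neg T, Pos (A i), Pos T], Pos (A i) # map (\<lambda>j. Pos (A j)) (w i)) | i. i \<in> {1..k}}"

definition Gk :: "nat \<Rightarrow> (nat \<Rightarrow> nat list) \<Rightarrow> gk_gen gword set monoid"
  where "Gk k w = presented_group (Gk_gens k) (Gk_rels k w)"

definition Gk_gen :: "nat \<Rightarrow> (nat \<Rightarrow> nat list) \<Rightarrow> gk_gen \<Rightarrow> gk_gen gword set"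
  where "Gk_gen k w x = pres_class (Gk_gens k) (Gk_rels k w) [Pos x]"

definition Hk :: "nat \<Rightarrow> (nat \<Rightarrow> nat list) \<Rightarrow> gk_gen gword set set"
  where "Hk k w =
    generate (Gk k w) ((\<lambda>i. Gk_gen k w (A i) \<otimes>\<^bsub>Gk k w\<^esub> Gk_gen k w T) ` {1..k})"

definition Gammak :: "nat \<Rightarrow> (nat \<Rightarrow> nat list) \<Rightarrow> gk_gen gword set hnn_gen gword set monoid"
  where "Gammak k w = hnn_extension (Gk k w) (Hk k w) (\<lambda>h. h)"

end

theory Submission
  imports Defs "HOL-Library.Countable_Set" "HOL-Algebra.Multiplicative_Group"
begin

text \<open>
  Let i be the first index with a nonempty word and put \<open>g = a\<^sub>i\<^sup>-\<^sup>1 (a\<^sub>1 t) a\<^sub>i\<close>. In a finite quotient the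
  orbit of the coset H under t is finite and each \<open>a\<^sub>l\<close> maps it into itself, hence permutes it; as \<open>a\<^sub>1 t\<close>
  fixes it pointwise, the image of g lies in the image of H. In an infinite orbit \<open>a\<^sub>i\<close> need not be
  surjective: writing s for the inverse of t, the hydra rule \<open>s a\<^sub>l = a\<^sub>l w\<^sub>l s\<close> forces \<open>a\<^sub>l\<close> to act on the
  points \<open>0, 1, 2, \<dots>\<close> of the orbit by a strictly increasing map. This partial action extends to an
  action of the whole group by permutations in which H fixes the base point and g moves it, so g is
  not in H and H is not separable. If all words are empty then t is central and H is the kernel of
  the homomorphism to the integers with \<open>t \<mapsto> 1\<close> and \<open>a\<^sub>i \<mapsto> -1\<close>.
\<close>

section \<open>Homomorphisms from presented groups\<close>

text \<open>Composition is reversed so that products act from the right: a word applies its letters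
  in reading order.\<close>

definition perms :: "('a \<Rightarrow> 'a) monoid"
  where "perms = \<lparr>carrier = {p. bij p}, monoid.mult = (\<lambda>p q. q \<circ> p), one = id\<rparr>"

lemma perms_simps [simp]:
  "carrier perms = {p. bij p}" "p \<otimes>\<^bsub>perms\<^esub> q = q \<circ> p" "\<one>\<^bsub>perms\<^esub> = id"
  by (simp_all add: perms_def)

lemma group_perms: "group perms"
proof (rule groupI)
  fix p :: "'a \<Rightarrow> 'a"
  assume "p \<in> carrier perms"
  then show "\<exists>q\<in>carrier perms. q \<otimes>\<^bsub>perms\<^esub> p = \<one>\<^bsub>perms\<^esub>"
    by (intro bexI[of _ "inv_into UNIV p"])
      (auto simp: fun_eq_iff bij_imp_bij_inv bij_is_surj surj_f_inv_f)
qed (auto simp: bij_comp o_assoc)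

lemma inv_perms:
  assumes "bij p"
  shows "inv\<^bsub>perms\<^esub> p = inv_into UNIV p"
proof -
  interpret group perms by (rule group_perms)
  have "inv_into UNIV p \<otimes>\<^bsub>perms\<^esub> p = \<one>\<^bsub>perms\<^esub>"
    using assms by (auto simp: fun_eq_iff bij_is_surj surj_f_inv_f)
  then show ?thesis
    using assms by (intro inv_equality) (auto simp: bij_imp_bij_inv)
qed

section \<open>Evaluation of words and the universal property of presentations\<close>

primrec letter_val :: "('g, 'm) monoid_scheme \<Rightarrow> ('x \<Rightarrow> 'g) \<Rightarrow> 'x letter \<Rightarrow> 'g"
  where
    "letter_val K f (Pos x) = f x"
  | "letter_val K f (Neg x) = inv\<^bsub>K\<^esub> f x"

primrec word_val :: "('g, 'm) monoid_scheme \<Rightarrow> ('x \<Rightarrow> 'g) \<Rightarrow> 'x gword \<Rightarrow> 'g"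
  where
    "word_val K f [] = \<one>\<^bsub>K\<^esub>"
  | "word_val K f (l # u) = letter_val K f l \<otimes>\<^bsub>K\<^esub> word_val K f u"

lemma gwords_simps [simp]:
  "[] \<in> gwords X"
  "Pos x # u \<in> gwords X \<longleftrightarrow> x \<in> X \<and> u \<in> gwords X"
  "Neg x # u \<in> gwords X \<longleftrightarrow> x \<in> X \<and> u \<in> gwords X"
  "u @ v \<in> gwords X \<longleftrightarrow> u \<in> gwords X \<and> v \<in> gwords X"
  by (auto simp: gwords_def)

lemma gwords_induct [consumes 1, case_names Nil Pos Neg]:
  assumes "u \<in> gwords X" "P []"
    and "\<And>x u. x \<in> X \<Longrightarrow> u \<in> gwords X \<Longrightarrow> P u \<Longrightarrow> P (Pos x # u)"
    and "\<And>x u. x \<in> X \<Longrightarrow> u \<in> gwords X \<Longrightarrow> P u \<Longrightarrow> P (Neg x # u)"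
  shows "P u"
  using assms(1)
proof (induction u)
  case (Cons l u)
  then show ?case using assms(3,4) by (cases l) auto
qed (rule assms(2))

context group
begin

lemma word_val_closed:
  assumes "u \<in> gwords X" "f \<in> X \<rightarrow> carrier G"
  shows "word_val G f u \<in> carrier G"
  using assms by (induction rule: gwords_induct) auto

lemma word_val_append:
  assumes "u \<in> gwords X" "v \<in> gwords X" "f \<in> X \<rightarrow> carrier G"
  shows "word_val G f (u @ v) = word_val G f u \<otimes> word_val G f v"
  using assms
proof (induction rule: gwords_induct)
  case (Pos x u)
  then have "f x \<in> carrier G" by auto
  then show ?case using Pos word_val_closed[of _ X f] by (simp add: m_assoc)
next
  case (Neg x u)
  then have "f x \<in> carrier G" by auto
  then show ?case using Neg word_val_closed[of _ X f] by (simp add: m_assoc)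
qed (simp add: word_val_closed[of _ X f])

lemma word_val_pres_cong:
  assumes "(u, v) \<in> pres_cong X R" "f \<in> X \<rightarrow> carrier G"
    and "\<And>u v. (u, v) \<in> R \<Longrightarrow> word_val G f u = word_val G f v"
  shows "word_val G f u = word_val G f v"
  using assms(1)
proof induction
  case (append u v u' v')
  then show ?case
    using word_val_append[OF _ _ assms(2)] pres_cong_gwords by metis
next
  case (cancel_right x)
  then have "f x \<in> carrier G" using assms(2) by auto
  then show ?case by simp
next
  case (cancel_left x)
  then have "f x \<in> carrier G" using assms(2) by auto
  then show ?case by simp
qed (simp_all add: assms(3))

text \<open>Evaluation is constant on congruence classes, so any chosen representative of a class
  may be evaluated.\<close>

lemma presented_group_hom:
  assumes "f \<in> X \<rightarrow> carrier G"
    and "\<And>u v. (u, v) \<in> R \<Longrightarrow> word_val G f u = word_val G f v"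
  obtains \<Phi> where "\<Phi> \<in> hom (presented_group X R) G"
    "\<And>u. u \<in> gwords X \<Longrightarrow> \<Phi> (pres_class X R u) = word_val G f u"
proof -
  define \<Phi> where "\<Phi> c = word_val G f (SOME u. u \<in> c)" for c
  have val: "\<Phi> (pres_class X R u) = word_val G f u" if "u \<in> gwords X" for u
  proof -
    have "u \<in> pres_class X R u"
      using that by (simp add: pres_class_def pres_cong.refl)
    then have "(SOME v. v \<in> pres_class X R u) \<in> pres_class X R u"
      by (rule someI)
    then have "(u, SOME v. v \<in> pres_class X R u) \<in> pres_cong X R"
      by (simp add: pres_class_def)
    from word_val_pres_cong[OF this assms] show ?thesis by (simp add: \<Phi>_def)
  qed
  have "\<Phi> \<in> hom (presented_group X R) G"
    by (rule homI)
      (auto simp: carrier_presented_group val mult_presented_group word_val_closed[OF _ assms(1)]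
        word_val_append[OF _ _ assms(1)])
  then show ?thesis using val that by blast
qed

end

lemma hom_word_val:
  assumes "group G" "group K" "\<phi> \<in> hom G K" "f \<in> X \<rightarrow> carrier G" "u \<in> gwords X"
  shows "\<phi> (word_val G f u) = word_val K (\<lambda>x. \<phi> (f x)) u"
proof -
  interpret G: group G by fact
  interpret K: group K by fact
  interpret group_hom G K \<phi> by unfold_locales fact
  show ?thesis
    using assms(5)
  proof (induction rule: gwords_induct)
    case (Pos x u)
    then have "f x \<in> carrier G" "word_val G f u \<in> carrier G"
      using assms(4) G.word_val_closed[of u X f] by auto
    then show ?case using Pos by simp
  next
    case (Neg x u)
    then have "f x \<in> carrier G" "word_val G f u \<in> carrier G"
      using assms(4) G.word_val_closed[of u X f] by auto
    then show ?case using Neg by simp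
  qed simp
qed

lemma pres_class_closed:
  "u \<in> gwords X \<Longrightarrow> pres_class X R u \<in> carrier (presented_group X R)"
  by (auto simp: carrier_presented_group)

lemma inv_pres_class_gen:
  assumes "x \<in> X"
  shows "inv\<^bsub>presented_group X R\<^esub> pres_class X R [Pos x] = pres_class X R [Neg x]"
proof -
  interpret group "presented_group X R" by (rule group_presented_group)
  have "pres_class X R [Neg x] \<otimes>\<^bsub>presented_group X R\<^esub> pres_class X R [Pos x]
    = \<one>\<^bsub>presented_group X R\<^esub>"
    using assms by (simp add: mult_presented_group one_presented_group pres_class_eq_iff
      pres_cong.cancel_left)
  then show ?thesis
    using assms by (intro inv_equality) (auto simp: pres_class_closed)
qed

text \<open>It turns elements of a presented group into values of words, so that
  \<open>hom_word_val\<close> computes any homomorphism from its values on generators.\<close>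

lemma word_val_presented_group:
  assumes "u \<in> gwords X"
  shows "word_val (presented_group X R) (\<lambda>x. pres_class X R [Pos x]) u = pres_class X R u"
  using assms
  by (induction rule: gwords_induct)
    (auto simp: one_presented_group mult_presented_group inv_pres_class_gen)

lemma pres_class_rel:
  assumes "(u, v) \<in> R" "u \<in> gwords X" "v \<in> gwords X"
  shows "pres_class X R u = pres_class X R v"
  using assms by (simp add: pres_class_eq_iff pres_cong.rel)

section \<open>Finite quotients\<close>

definition positive_word :: "nat list \<Rightarrow> gk_gen gword"
  where "positive_word u = map (\<lambda>j. Pos (A j)) u"

lemma positive_word_simps [simp]:
  "positive_word [] = []" "positive_word (j # u) = Pos (A j) # positive_word u"
  by (simp_all add: positive_word_def)

lemma positive_word_gwords:
  "set u \<subseteq> {1..k} \<Longrightarrow> positive_word u \<in> gwords (Gk_gens k)"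
  by (induction u) (auto simp: Gk_gens_def)

lemma T_in_gens: "T \<in> Gk_gens k" and A_in_gens: "A i \<in> Gk_gens k \<longleftrightarrow> i \<in> {1..k}"
  by (auto simp: Gk_gens_def)

text \<open>The group and the images of the generators are arbitrary because the witness is
  evaluated in \<open>Gk k w\<close>, in \<open>perms\<close> and in finite quotients.\<close>

definition conj_elt :: "('g, 'm) monoid_scheme \<Rightarrow> (gk_gen \<Rightarrow> 'g) \<Rightarrow> nat \<Rightarrow> 'g"
  where "conj_elt K f i =
    inv\<^bsub>K\<^esub> f (A i) \<otimes>\<^bsub>K\<^esub> (f (A 1) \<otimes>\<^bsub>K\<^esub> f T) \<otimes>\<^bsub>K\<^esub> f (A i)"

locale triangular_words =
  fixes k :: nat and w :: "nat \<Rightarrow> nat list"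
  assumes lower: "\<forall>i\<in>{1..k}. set (w i) \<subseteq> {1..<i}"
begin

lemma group_Gk: "group (Gk k w)"
  by (simp add: Gk_def group_presented_group)

lemma Gk_gen_closed: "Gk_gen k w \<in> Gk_gens k \<rightarrow> carrier (Gk k w)"
  by (auto simp: Gk_gen_def Gk_def pres_class_closed)

lemma Gk_rels_gwords:
  assumes "(u, v) \<in> Gk_rels k w"
  shows "u \<in> gwords (Gk_gens k)" "v \<in> gwords (Gk_gens k)"
proof -
  obtain i where i: "i \<in> {1..k}" "u = [Neg T, Pos (A i), Pos T]"
    "v = Pos (A i) # positive_word (w i)"
    using assms by (auto simp: Gk_rels_def positive_word_def)
  then show "u \<in> gwords (Gk_gens k)" "v \<in> gwords (Gk_gens k)"
    using lower by (fastforce simp: T_in_gens A_in_gens intro!: positive_word_gwords)+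
qed

lemma Gk_rel:
  assumes "(u, v) \<in> Gk_rels k w"
  shows "word_val (Gk k w) (Gk_gen k w) u = word_val (Gk k w) (Gk_gen k w) v"
  using assms Gk_rels_gwords[OF assms] unfolding Gk_def Gk_gen_def
  by (simp add: word_val_presented_group pres_class_rel)

lemma hom_Gk_rel:
  assumes "group K" "\<phi> \<in> hom (Gk k w) K" "(u, v) \<in> Gk_rels k w"
  shows "word_val K (\<lambda>x. \<phi> (Gk_gen k w x)) u = word_val K (\<lambda>x. \<phi> (Gk_gen k w x)) v"
  using Gk_rel[OF assms(3)] Gk_rels_gwords[OF assms(3)]
    hom_word_val[OF group_Gk assms(1,2) Gk_gen_closed] by metis

lemma gen_times_T_in_Hk:
  assumes "i \<in> {1..k}"
  shows "Gk_gen k w (A i) \<otimes>\<^bsub>Gk k w\<^esub> Gk_gen k w T \<in> Hk k w"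
  using assms unfolding Hk_def by (blast intro: generate.incl)

lemma subgroup_Hk: "subgroup (Hk k w) (Gk k w)"
proof -
  interpret group "Gk k w" by (rule group_Gk)
  show ?thesis
    unfolding Hk_def using Gk_gen_closed
    by (intro generate_is_subgroup) (auto simp: Pi_iff A_in_gens T_in_gens intro!: m_closed)
qed

lemma conj_elt_closed:
  assumes "group K" "f \<in> Gk_gens k \<rightarrow> carrier K" "i \<in> {1..k}"
  shows "conj_elt K f i \<in> carrier K"
proof -
  interpret group K by fact
  have "f (A i) \<in> carrier K" "f (A 1) \<in> carrier K" "f T \<in> carrier K"
    using assms(2,3) by (auto simp: Pi_iff A_in_gens T_in_gens)
  then show ?thesis by (simp add: conj_elt_def)
qed

lemma hom_conj_elt:
  assumes "group K" "\<phi> \<in> hom (Gk k w) K" "i \<in> {1..k}"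
  shows "\<phi> (conj_elt (Gk k w) (Gk_gen k w) i) = conj_elt K (\<lambda>x. \<phi> (Gk_gen k w x)) i"
proof -
  interpret G: group "Gk k w" by (rule group_Gk)
  interpret K: group K by fact
  interpret group_hom "Gk k w" K \<phi> by unfold_locales fact
  have "Gk_gen k w (A i) \<in> carrier (Gk k w)" "Gk_gen k w (A 1) \<in> carrier (Gk k w)"
    "Gk_gen k w T \<in> carrier (Gk k w)"
    using assms(3) Gk_gen_closed by (auto simp: Pi_iff A_in_gens T_in_gens)
  then show ?thesis by (simp add: conj_elt_def)
qed

text \<open>
  The set of all \<open>h t\<^sup>-\<^sup>n\<close> with h in S and n a natural number is closed under right multiplication by
  every \<open>a\<^sub>l\<close>; in a finite group it therefore contains the inverse of \<open>a\<^sub>i\<close>, which is a power of \<open>a\<^sub>i\<close>.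
\<close>

lemma conj_elt_finite:
  assumes Q: "group Q" "finite (carrier Q)" and S: "subgroup S Q"
    and f: "f \<in> Gk_gens k \<rightarrow> carrier Q"
    and rel: "\<And>u v. (u, v) \<in> Gk_rels k w \<Longrightarrow> word_val Q f u = word_val Q f v"
    and gen: "\<And>i. i \<in> {1..k} \<Longrightarrow> f (A i) \<otimes>\<^bsub>Q\<^esub> f T \<in> S"
    and i: "i \<in> {1..k}"
  shows "conj_elt Q f i \<in> S"
proof -
  interpret group Q by fact
  interpret S: subgroup S Q by fact
  let ?s = "inv\<^bsub>Q\<^esub> f T"
  have T: "f T \<in> carrier Q" using f by (auto simp: T_in_gens)
  have A: "f (A l) \<in> carrier Q" if "l \<in> {1..k}" for l
    using f that by (auto simp: Pi_iff A_in_gens)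
  define P where "P = {h \<otimes>\<^bsub>Q\<^esub> ?s [^]\<^bsub>Q\<^esub> n | h n::nat. h \<in> S}"
  have P_closed: "P \<subseteq> carrier Q" using T by (auto simp: P_def)
  have P_s: "x \<otimes>\<^bsub>Q\<^esub> ?s \<in> P" if x: "x \<in> P" for x
  proof -
    obtain h and n :: nat where "h \<in> S" "x = h \<otimes>\<^bsub>Q\<^esub> ?s [^]\<^bsub>Q\<^esub> n"
      using x by (auto simp: P_def)
    then have "x \<otimes>\<^bsub>Q\<^esub> ?s = h \<otimes>\<^bsub>Q\<^esub> ?s [^]\<^bsub>Q\<^esub> Suc n" using T by (simp add: m_assoc)
    then show ?thesis using \<open>h \<in> S\<close> unfolding P_def by blast
  qed
  have P_S: "h \<otimes>\<^bsub>Q\<^esub> x \<in> P" if x: "x \<in> P" "h \<in> S" for x h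
  proof -
    obtain h' and n :: nat where "h' \<in> S" "x = h' \<otimes>\<^bsub>Q\<^esub> ?s [^]\<^bsub>Q\<^esub> n"
      using x by (auto simp: P_def)
    then have "h \<otimes>\<^bsub>Q\<^esub> x = (h \<otimes>\<^bsub>Q\<^esub> h') \<otimes>\<^bsub>Q\<^esub> ?s [^]\<^bsub>Q\<^esub> n" "h \<otimes>\<^bsub>Q\<^esub> h' \<in> S"
      using T \<open>h \<in> S\<close> by (simp_all add: m_assoc)
    then show ?thesis unfolding P_def by blast
  qed
  have one_P: "\<one>\<^bsub>Q\<^esub> \<in> P"
  proof -
    have "\<one>\<^bsub>Q\<^esub> = \<one>\<^bsub>Q\<^esub> \<otimes>\<^bsub>Q\<^esub> ?s [^]\<^bsub>Q\<^esub> (0::nat)" by simp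
    then show ?thesis using S.one_closed unfolding P_def by blast
  qed
  \<comment> \<open>The hydra rule: \<open>t^-1\<close> passes \<open>a_l\<close> at the cost of the
    word \<open>w l\<close>.\<close>
  have swap: "?s \<otimes>\<^bsub>Q\<^esub> f (A l) = f (A l) \<otimes>\<^bsub>Q\<^esub> word_val Q f (positive_word (w l)) \<otimes>\<^bsub>Q\<^esub> ?s"
    if l: "l \<in> {1..k}" for l
  proof -
    have "word_val Q f [Neg T, Pos (A l), Pos T] = word_val Q f (Pos (A l) # positive_word (w l))"
      using l by (intro rel) (auto simp: Gk_rels_def positive_word_def)
    then have "?s \<otimes>\<^bsub>Q\<^esub> f (A l) \<otimes>\<^bsub>Q\<^esub> f T = f (A l) \<otimes>\<^bsub>Q\<^esub> word_val Q f (positive_word (w l))"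
      using T A[OF l] by (simp add: m_assoc)
    then have "f (A l) \<otimes>\<^bsub>Q\<^esub> word_val Q f (positive_word (w l)) \<otimes>\<^bsub>Q\<^esub> ?s
      = ?s \<otimes>\<^bsub>Q\<^esub> f (A l) \<otimes>\<^bsub>Q\<^esub> f T \<otimes>\<^bsub>Q\<^esub> ?s" by simp
    also have "\<dots> = ?s \<otimes>\<^bsub>Q\<^esub> f (A l)" using T A[OF l] by (simp add: m_assoc)
    finally show ?thesis ..
  qed
  \<comment> \<open>Strong induction works because moving \<open>t^-1\<close> past
    \<open>a_l\<close> creates only letters smaller than \<open>l\<close>.\<close>
  have P_A: "\<forall>x\<in>P. x \<otimes>\<^bsub>Q\<^esub> f (A l) \<in> P" if l: "l \<in> {1..k}" for l
    using l
  proof (induction l rule: less_induct)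
    case (less l)
    have W: "x \<otimes>\<^bsub>Q\<^esub> word_val Q f (positive_word u) \<in> P"
      if "x \<in> P" "set u \<subseteq> {1..<l}" for x u
      using that
    proof (induction u arbitrary: x)
      case Nil
      then show ?case using P_closed by auto
    next
      case (Cons m u)
      then have m: "m \<in> {1..k}" "m < l" and xm: "x \<otimes>\<^bsub>Q\<^esub> f (A m) \<in> P"
        using less by auto
      have "word_val Q f (positive_word u) \<in> carrier Q"
        using Cons.prems less.prems
        by (intro word_val_closed[OF positive_word_gwords f]) auto
      then have "x \<otimes>\<^bsub>Q\<^esub> word_val Q f (positive_word (m # u))
        = (x \<otimes>\<^bsub>Q\<^esub> f (A m)) \<otimes>\<^bsub>Q\<^esub> word_val Q f (positive_word u)"
        using Cons.prems P_closed A[OF m(1)] by (auto simp: m_assoc)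
      also have "\<dots> \<in> P" using Cons xm by auto
      finally show ?case .
    qed
    have wl: "set (w l) \<subseteq> {1..<l}" using lower less.prems by blast
    have Wl: "word_val Q f (positive_word (w l)) \<in> carrier Q"
      using wl less.prems by (intro word_val_closed[OF positive_word_gwords f]) auto
    note Al = A[OF less.prems]
    have pow: "?s [^]\<^bsub>Q\<^esub> n \<otimes>\<^bsub>Q\<^esub> f (A l) \<in> P" for n :: nat
    proof (induction n)
      case 0
      \<comment> \<open>Cancelling \<open>t\<close> exhibits \<open>a_l\<close> as the element
        \<open>a_l t\<close> of \<open>S\<close> followed by \<open>t^-1\<close>.\<close>
      have "f (A l) = (f (A l) \<otimes>\<^bsub>Q\<^esub> f T) \<otimes>\<^bsub>Q\<^esub> (\<one>\<^bsub>Q\<^esub> \<otimes>\<^bsub>Q\<^esub> ?s)"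
        using T Al by (simp add: m_assoc)
      also have "\<dots> \<in> P" by (intro P_S P_s one_P gen less.prems)
      finally show ?case using Al by simp
    next
      case (Suc n)
      have "?s [^]\<^bsub>Q\<^esub> Suc n \<otimes>\<^bsub>Q\<^esub> f (A l) = ?s [^]\<^bsub>Q\<^esub> n \<otimes>\<^bsub>Q\<^esub> (?s \<otimes>\<^bsub>Q\<^esub> f (A l))"
        using T Al by (simp add: m_assoc)
      also have "\<dots> = ?s [^]\<^bsub>Q\<^esub> n \<otimes>\<^bsub>Q\<^esub> f (A l) \<otimes>\<^bsub>Q\<^esub> word_val Q f (positive_word (w l)) \<otimes>\<^bsub>Q\<^esub> ?s"
        unfolding swap[OF less.prems] using T Al Wl by (simp add: m_assoc)
      also have "\<dots> \<in> P" by (intro P_s W Suc wl)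
      finally show ?case .
    qed
    show ?case
    proof
      fix x assume "x \<in> P"
      then obtain h and n :: nat where h: "h \<in> S" "x = h \<otimes>\<^bsub>Q\<^esub> ?s [^]\<^bsub>Q\<^esub> n"
        by (auto simp: P_def)
      then have "x \<otimes>\<^bsub>Q\<^esub> f (A l) = h \<otimes>\<^bsub>Q\<^esub> (?s [^]\<^bsub>Q\<^esub> n \<otimes>\<^bsub>Q\<^esub> f (A l))"
        using T Al by (simp add: m_assoc)
      then show "x \<otimes>\<^bsub>Q\<^esub> f (A l) \<in> P" using P_S[OF pow h(1)] by simp
    qed
  qed
  note Ai = A[OF i]
  have powers: "f (A i) [^]\<^bsub>Q\<^esub> m \<in> P" for m :: nat
    by (induction m) (use one_P P_A[OF i] in auto)
  have "f (A i) [^]\<^bsub>Q\<^esub> (order Q - 1) \<otimes>\<^bsub>Q\<^esub> f (A i) = f (A i) [^]\<^bsub>Q\<^esub> Suc (order Q - 1)"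
    by simp
  also have "\<dots> = \<one>\<^bsub>Q\<^esub>"
    using pow_order_eq_1[OF Ai] order_gt_0_iff_finite Q(2) by simp
  finally have "inv\<^bsub>Q\<^esub> f (A i) = f (A i) [^]\<^bsub>Q\<^esub> (order Q - 1)"
    using Ai by (intro inv_equality) auto
  then have "inv\<^bsub>Q\<^esub> f (A i) \<in> P" using powers by simp
  then obtain h and n :: nat where h: "h \<in> S" "inv\<^bsub>Q\<^esub> f (A i) = h \<otimes>\<^bsub>Q\<^esub> ?s [^]\<^bsub>Q\<^esub> n"
    by (auto simp: P_def)
  have one: "1 \<in> {1..k}" using i by auto
  note A1 = A[OF one]
  \<comment> \<open>No letter precedes \<open>a_1\<close>, so its word is empty and
    \<open>t^-1\<close> commutes with \<open>a_1\<close>, hence with \<open>a_1 t\<close>.\<close>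
  have "w 1 = []" using lower one by fastforce
  then have comm: "?s \<otimes>\<^bsub>Q\<^esub> f (A 1) = f (A 1) \<otimes>\<^bsub>Q\<^esub> ?s" using swap[OF one] A1 by simp
  have "?s \<otimes>\<^bsub>Q\<^esub> (f (A 1) \<otimes>\<^bsub>Q\<^esub> f T) = (f (A 1) \<otimes>\<^bsub>Q\<^esub> f T) \<otimes>\<^bsub>Q\<^esub> ?s"
    using comm T A1 by (simp flip: m_assoc) (simp add: m_assoc)
  then have "?s [^]\<^bsub>Q\<^esub> n \<otimes>\<^bsub>Q\<^esub> (f (A 1) \<otimes>\<^bsub>Q\<^esub> f T) = (f (A 1) \<otimes>\<^bsub>Q\<^esub> f T) \<otimes>\<^bsub>Q\<^esub> ?s [^]\<^bsub>Q\<^esub> n"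
    using T A1 by (metis group_commutes_pow inv_closed m_closed)
  moreover have "f (A i) = inv\<^bsub>Q\<^esub> (?s [^]\<^bsub>Q\<^esub> n) \<otimes>\<^bsub>Q\<^esub> inv\<^bsub>Q\<^esub> h"
    using h Ai T by (metis inv_closed inv_inv inv_mult_group nat_pow_closed S.mem_carrier)
  \<comment> \<open>After substituting \<open>h t^-n\<close> for the inverse of \<open>a_i\<close>,
    the powers of \<open>t\<close> cancel and a conjugate of \<open>a_1 t\<close> by an element of
    \<open>S\<close> remains.\<close>
  ultimately have "conj_elt Q f i = h \<otimes>\<^bsub>Q\<^esub> (f (A 1) \<otimes>\<^bsub>Q\<^esub> f T) \<otimes>\<^bsub>Q\<^esub> inv\<^bsub>Q\<^esub> h"
    unfolding conj_elt_def h(2) using h(1) T A1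
    by (simp add: m_assoc del: inv_mult_group) (simp flip: m_assoc del: inv_mult_group)
  then show ?thesis using h(1) gen[OF one] by simp
qed

end

section \<open>Extending the action on the orbit of the base point\<close>

text \<open>A point that never returns spans a copy of the integers on which \<open>p\<close> is the
  shift; negative indices come from the inverse of \<open>p\<close>.\<close>

lemma bij_orbit_line:
  assumes p: "bij p" and x: "\<And>n. n > 0 \<Longrightarrow> (p ^^ n) x \<noteq> x"
  obtains g :: "int \<Rightarrow> 'a" where "inj g" "g 0 = x" "\<And>n. p (g n) = g (n + 1)"
proof -
  define g where "g n = (if n \<ge> 0 then (p ^^ nat n) x else (inv_into UNIV p ^^ nat (- n)) x)" for n
  have step: "p (g n) = g (n + 1)" for n
  proof (cases "n \<ge> 0")
    case True
    then have "nat (n + 1) = Suc (nat n)" by simp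
    then show ?thesis using True by (simp add: g_def)
  next
    case False
    define m where "m = nat (- n - 1)"
    then have m: "nat (- n) = Suc m" "nat (- (n + 1)) = m" using False by auto
    have "p (g n) = (inv_into UNIV p ^^ m) x"
      using False m p by (simp add: g_def bij_is_surj surj_f_inv_f)
    moreover have "n + 1 = 0 \<or> n + 1 < 0" using False by auto
    ultimately show ?thesis using m by (auto simp: g_def)
  qed
  have steps: "(p ^^ m) (g n) = g (n + int m)" for m n
    by (induction m) (auto simp: step algebra_simps)
  have "g m \<noteq> g n" if "m < n" for m n
  proof
    define d where "d = nat (n - m)"
    assume eq: "g m = g n"
    have shift: "g (m + int j) = g (n + int j)" for j
      using steps[of j m] steps[of j n] eq by simp
    have inj: "inj (p ^^ j)" for j using p by (simp add: bij_is_inj inj_fn)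
    \<comment> \<open>A coincidence is moved to index 0: forwards by iterating \<open>p\<close> if
      \<open>m\<close> is at most 0, otherwise backwards by injectivity.\<close>
    have "g 0 = g (int d)"
    proof (cases "m \<le> 0")
      case True
      then show ?thesis using shift[of "nat (- m)"] that by (simp add: d_def)
    next
      case False
      have "(p ^^ nat m) (g 0) = (p ^^ nat m) (g (int d))"
        unfolding steps using eq that False by (simp add: d_def)
      then show ?thesis using inj by (simp add: inj_eq)
    qed
    moreover have "d > 0" using that by (simp add: d_def)
    ultimately show False using x[of d] by (simp add: g_def)
  qed
  then have "inj g" by (metis injI linorder_neqE)
  moreover have "g 0 = x" by (simp add: g_def)
  ultimately show ?thesis using step that by blast
qed

text \<open>
  Here s is the action of \<open>t\<^sup>-\<^sup>1\<close>, and \<open>f n\<close> is the point reached from the base point \<open>f 0\<close>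
  by \<open>t\<^sup>-\<^sup>n\<close>. Groups act from the right, so \<^term>\<open>fold a u\<close> is the action of the positive word u.
\<close>

definition hydra_action ::
    "(nat \<Rightarrow> nat list) \<Rightarrow> nat \<Rightarrow> ('a \<Rightarrow> 'a) \<Rightarrow> (nat \<Rightarrow> 'a \<Rightarrow> 'a) \<Rightarrow> (int \<Rightarrow> 'a) \<Rightarrow> bool"
  where "hydra_action w j s a f \<longleftrightarrow> bij s \<and> inj f \<and> (\<forall>n. s (f n) = f (n + 1)) \<and>
    (\<forall>l\<in>{1..j}. bij (a l) \<and> a l (f 0) = f 1 \<and>
      (\<forall>m\<ge>0. \<exists>m'>m. a l (f m) = f m') \<and>
      (\<forall>y. a l (s y) = s (fold a (w l) (a l y))))"

lemma fold_conjugate: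
  assumes "\<And>l y. l \<in> set u \<Longrightarrow> b l (e y) = e (a l y)"
  shows "fold b u (e y) = e (fold a u y)"
  using assms by (induction u arbitrary: y) auto

lemma bij_fold:
  assumes "\<And>l. l \<in> set u \<Longrightarrow> bij (a l)"
  shows "bij (fold a u)"
  using assms by (induction u) (auto simp: bij_comp)

text \<open>Conjugation by \<open>e\<close> respects every condition, so an action can be moved to
  another type of the same size.\<close>

lemma hydra_action_transport:
  assumes "hydra_action w j s a f" and e: "bij e"
  shows "hydra_action w j (e \<circ> s \<circ> inv_into UNIV e) (\<lambda>l. e \<circ> a l \<circ> inv_into UNIV e) (e \<circ> f)"
proof -
  note inj = bij_is_inj[OF e]
  have i: "inv_into UNIV e (e y) = y" for y using inj by simp
  have "fold (\<lambda>l. e \<circ> a l \<circ> inv_into UNIV e) u (e y) = e (fold a u y)" for u y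
    by (rule fold_conjugate) (simp add: i)
  then show ?thesis
    using assms unfolding hydra_action_def
    by (auto simp: i bij_comp bij_imp_bij_inv inj_compose inj inj_eq)
qed

section \<open>Padding by copies, to conjugate one permutation to another along given lines\<close>

type_synonym 'a padded = "'a + bool \<times> nat \<times> 'a"

text \<open>The tags \<open>True\<close> and \<open>False\<close> mark the reserves of copies for
  \<open>s\<close> and for \<open>q\<close>. The parameter \<open>p\<close> is separate because the
  two permutations to be conjugated, \<open>pad_shift s s q\<close> and
  \<open>pad_shift q s q\<close>, differ only on the original points.\<close>

definition pad_shift :: "('a \<Rightarrow> 'a) \<Rightarrow> ('a \<Rightarrow> 'a) \<Rightarrow> ('a \<Rightarrow> 'a) \<Rightarrow> 'a padded \<Rightarrow> 'a padded"
  where "pad_shift p s q = map_sum p (\<lambda>(b, n, y). (b, n, if b then s y else q y))"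

text \<open>A Hilbert hotel: the line \<open>f\<close> goes to the line \<open>g\<close>, the other
  original points are pushed into the copies tagged \<open>b\<close>, and the places off
  \<open>g\<close> are refilled from the copies with the other tag.\<close>

fun pad_conj :: "bool \<Rightarrow> (int \<Rightarrow> 'a) \<Rightarrow> (int \<Rightarrow> 'a) \<Rightarrow> 'a padded \<Rightarrow> 'a padded"
  where
    "pad_conj b f g (Inl y) =
      (if y \<in> range f then Inl (g (inv_into UNIV f y)) else Inr (b, 0, y))"
  | "pad_conj b f g (Inr (c, n, y)) =
      (if c = b then Inr (c, if y \<in> range f then n else Suc n, y)
       else if y \<in> range g then Inr (c, n, y)
       else case n of 0 \<Rightarrow> Inl y | Suc m \<Rightarrow> Inr (c, m, y))"

text \<open>Exchanging the tags and the lines turns pushing into pulling, so the inverse is an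
  instance of the same definition.\<close>

lemma pad_conj_inverse:
  assumes "inj f" "inj g"
  shows "pad_conj (\<not> b) g f (pad_conj b f g z) = z"
proof (cases "(b, f, g, z)" rule: pad_conj.cases)
  case (1 b f g y)
  then show ?thesis using assms by (auto)
next
  case (2 b f g c n y)
  then show ?thesis using assms by (auto split: nat.split)
qed

lemma bij_pad_conj:
  assumes "inj f" "inj g"
  shows "bij (pad_conj b f g)"
  using pad_conj_inverse[OF assms, of b] pad_conj_inverse[OF assms(2,1), of "\<not> b"]
  by (intro o_bij[of "pad_conj (\<not> b) g f"]) (auto simp: fun_eq_iff)

lemma bij_map_sum_id:
  assumes "bij p"
  shows "bij (map_sum p (id :: 'b \<Rightarrow> 'b))"
proof (rule o_bij)
  let ?r = "map_sum (inv_into UNIV p) (id :: 'b \<Rightarrow> 'b)"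
  show "?r \<circ> map_sum p id = id" "map_sum p id \<circ> ?r = id"
    using assms by (auto simp: fun_eq_iff bij_is_inj bij_is_surj surj_f_inv_f map_sum_def
        split: sum.split)
qed

lemma bij_pad_shift:
  assumes "bij p" "bij s" "bij q"
  shows "bij (pad_shift p s q)"
proof (rule o_bij)
  let ?r = "pad_shift (inv_into UNIV p) (inv_into UNIV s) (inv_into UNIV q)"
  show "?r \<circ> pad_shift p s q = id" "pad_shift p s q \<circ> ?r = id"
    using assms
    by (auto simp: fun_eq_iff pad_shift_def bij_is_inj bij_is_surj surj_f_inv_f map_sum_def
        split: sum.split)
qed

text \<open>This keeps the case distinctions of \<open>pad_conj\<close> stable under a
  shift.\<close>

lemma line_complement:
  assumes "bij p" "\<And>n::int. p (f n) = f (n + 1)"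
  shows "p y \<in> range f \<longleftrightarrow> y \<in> range f"
proof
  assume "p y \<in> range f"
  then obtain n where "p y = f n" by blast
  also have "f n = p (f (n - 1))" using assms(2)[of "n - 1"] by simp
  finally have "y = f (n - 1)" using assms(1) by (simp add: bij_is_inj inj_eq)
  then show "y \<in> range f" by simp
qed (use assms(2) in auto)

text \<open>On the line both sides raise the index by one. Elsewhere \<open>pad_conj\<close> changes
  only the copy, between places where the same permutation acts, and the shifts change only the
  point.\<close>

lemma pad_conj_shift:
  assumes s: "bij s" "inj f" "\<And>n. s (f n) = f (n + 1)"
    and q: "bij q" "inj g" "\<And>n. q (g n) = g (n + 1)"
  shows "pad_conj True f g (pad_shift s s q z) = pad_shift q s q (pad_conj True f g z)"
proof -
  have f: "s y \<in> range f \<longleftrightarrow> y \<in> range f" for y using line_complement[of s f y] s by auto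
  have g: "q y \<in> range g \<longleftrightarrow> y \<in> range g" for y using line_complement[of q g y] q by auto
  show ?thesis
  proof (cases z)
    case (Inl y)
    show ?thesis
    proof (cases "y \<in> range f")
      case True
      then obtain n where n: "y = f n" by blast
      then show ?thesis using Inl q(3)[of n] s(2,3) by (simp add: pad_shift_def)
    qed (use Inl f[of y] in \<open>simp add: pad_shift_def del: image_iff\<close>)
  next
    case (Inr x)
    obtain b n y where "x = (b, n, y)" by (cases x)
    then show ?thesis using Inr f[of y] g[of y] by (auto simp: pad_shift_def split: nat.split)
  qed
qed

text \<open>From nonnegative indices each letter moves forward and \<open>s\<close> adds one. Hence
  \<open>f 1\<close> never returns under \<open>q\<close>, and the letter constructed from this
  orbit again moves indices forward.\<close>

lemma hydra_action_orbit:
  assumes act: "hydra_action w j s a f" and v: "set v \<subseteq> {1..j}"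
    and q: "\<And>y. q y = s (fold a v y)"
  shows "\<exists>m>int n. (q ^^ n) (f 1) = f m"
proof (induction n)
  case 0
  then show ?case by (auto intro: exI[of _ 1])
next
  case (Suc n)
  have step: "\<exists>m'>m. a l (f m) = f m'" if "l \<in> {1..j}" "m \<ge> 0" for l m
    using act that by (auto simp: hydra_action_def)
  \<comment> \<open>The inequality is weak since the word may be empty; the strict gain in each
    round comes from \<open>s\<close>.\<close>
  have fold: "\<exists>m'\<ge>m. fold a u (f m) = f m'" if "m \<ge> 0" "set u \<subseteq> {1..j}" for m u
    using that
  proof (induction u arbitrary: m)
    case (Cons l u)
    obtain m' where m': "m' > m" "a l (f m) = f m'" using step[of l m] Cons.prems by auto
    moreover obtain m'' where "m'' \<ge> m'" "fold a u (f m') = f m''"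
      using Cons.IH[of m'] Cons.prems m' by auto
    ultimately show ?case by (intro exI[of _ m'']) simp
  qed auto
  obtain m where m: "m > int n" "(q ^^ n) (f 1) = f m" using Suc by blast
  then obtain m' where "m' \<ge> m" "fold a v (f m) = f m'" using fold[of m v] v by auto
  then have "(q ^^ Suc n) (f 1) = f (m' + 1)"
    using act m by (simp add: hydra_action_def q)
  then show ?case using m \<open>m' \<ge> m\<close> by (intro exI[of _ "m' + 1"]) (auto simp: add.commute)
qed

text \<open>
  The new permutation must conjugate s to the product q of s and the new word. On the orbits of the
  base point it is forced; the cycle types of s and q on the complements may differ, which is
  repaired by adding countably many copies of both.
\<close>

lemma hydra_action_step:
  fixes f :: "int \<Rightarrow> 'a"
  assumes act: "hydra_action w j s a f"
    and lower: "\<forall>l\<in>{1..Suc j}. set (w l) \<subseteq> {1..<l}"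
    and q: "q = s \<circ> fold a (w (Suc j))"
  obtains g :: "int \<Rightarrow> 'a" and a' :: "nat \<Rightarrow> 'a padded \<Rightarrow> 'a padded"
  where "g 0 = f 1" "\<And>n. q (g n) = g (n + 1)"
    "hydra_action w (Suc j) (pad_shift s s q) a' (Inl \<circ> f)"
    "\<And>l. l \<noteq> Suc j \<Longrightarrow> a' l = map_sum (a l) id"
    "a' (Suc j) = pad_conj True f g"
proof -
  let ?v = "w (Suc j)"
  have v: "set ?v \<subseteq> {1..j}" using lower by force
  have s: "bij s" "inj f" "\<And>n. s (f n) = f (n + 1)" using act by (auto simp: hydra_action_def)
  have a: "bij (a l)" "a l (f 0) = f 1" "\<And>m. m \<ge> 0 \<Longrightarrow> \<exists>m'>m. a l (f m) = f m'"
    "\<And>y. a l (s y) = s (fold a (w l) (a l y))" if "l \<in> {1..j}" for l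
    using act that by (auto simp: hydra_action_def)
  have q_apply: "q y = s (fold a ?v y)" for y by (simp add: q)
  have bij_q: "bij q" unfolding q using s(1) a(1) v by (intro bij_comp bij_fold) auto
  \<comment> \<open>Nonreturn provides the line \<open>g\<close> through \<open>f 1\<close>, onto
    which the new letter must carry the line \<open>f\<close>.\<close>
  have "(q ^^ n) (f 1) \<noteq> f 1" if "n > 0" for n
  proof -
    have "\<exists>m>int n. (q ^^ n) (f 1) = f m" by (rule hydra_action_orbit[OF act v q_apply])
    then obtain m where "m > int n" "(q ^^ n) (f 1) = f m" by blast
    then show ?thesis using s(2) that by (simp add: inj_eq)
  qed
  from bij_orbit_line[OF bij_q this] obtain g :: "int \<Rightarrow> 'a"
    where g: "inj g" "g 0 = f 1" "\<And>n. q (g n) = g (n + 1)" by blast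
  have g_pow: "(q ^^ n) (f 1) = g (int n)" for n
    by (induction n) (simp_all add: g add.commute)
  \<comment> \<open>Old letters fix all copies, where their relations therefore hold
    trivially.\<close>
  define a' where "a' l = (if l = Suc j then pad_conj True f g else map_sum (a l) id)" for l
  have fold_Inl: "fold a' u (Inl y) = Inl (fold a u y)"
    and fold_Inr: "fold a' u (Inr x) = Inr x" if "set u \<subseteq> {1..j}" for u y x
    using that by (induction u arbitrary: y) (auto simp: a'_def)
  \<comment> \<open>The new word acts only on the original points, where it turns \<open>s\<close>
    into \<open>q\<close>; the relation of the new letter thus becomes
    \<open>pad_conj_shift\<close>.\<close>
  have q': "pad_shift s s q (fold a' ?v z) = pad_shift q s q z" for z
    using v by (cases z) (simp_all add: fold_Inl fold_Inr, simp_all add: pad_shift_def q)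
  have "hydra_action w (Suc j) (pad_shift s s q) a' (Inl \<circ> f)"
    unfolding hydra_action_def
  proof (intro conjI ballI allI)
    show "bij (pad_shift s s q)" using s bij_q by (intro bij_pad_shift)
    show "inj (Inl \<circ> f)" using s(2) by (simp add: inj_compose)
    show "pad_shift s s q ((Inl \<circ> f) n) = (Inl \<circ> f) (n + 1)" for n
      using s(3) by (simp add: pad_shift_def)
    fix l assume l: "l \<in> {1..Suc j}"
    show "bij (a' l)"
    proof (cases "l = Suc j")
      case True
      then show ?thesis using s(2) g(1) by (simp add: a'_def bij_pad_conj)
    next
      case False
      then have b: "bij (a l)" using l a(1) by auto
      then show ?thesis using False by (simp add: a'_def bij_map_sum_id)
    qed
    show "a' l ((Inl \<circ> f) 0) = (Inl \<circ> f) 1"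
      using l a(2) g(2) s(2) by (auto simp: a'_def)
    show "m \<ge> 0 \<longrightarrow> (\<exists>m'>m. a' l ((Inl \<circ> f) m) = (Inl \<circ> f) m')" for m
    proof
      assume m: "m \<ge> 0"
      \<comment> \<open>\<open>g m\<close> is the \<open>m\<close>-th iterate of \<open>q\<close> at
        \<open>f 1\<close>, hence lies on the line \<open>f\<close> beyond index
        \<open>m\<close>.\<close>
      have "\<exists>m'>m. g m = f m'"
        using hydra_action_orbit[OF act v q_apply, of "nat m"] g_pow[of "nat m"] m by simp
      moreover have "\<exists>m'>m. a l (f m) = f m'" if "l \<noteq> Suc j" using a(3)[of l m] l m that by auto
      ultimately show "\<exists>m'>m. a' l ((Inl \<circ> f) m) = (Inl \<circ> f) m'"
        using s(2) by (auto simp: a'_def)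
    qed
    show "a' l (pad_shift s s q z) = pad_shift s s q (fold a' (w l) (a' l z))" for z
    proof (cases "l = Suc j")
      case True
      then show ?thesis using pad_conj_shift[OF s bij_q g(1,3), of z] q' by (simp add: a'_def)
    next
      case False
      then have l': "l \<in> {1..j}" "set (w l) \<subseteq> {1..j}" using l lower by fastforce+
      show ?thesis
        using False a(4)[OF l'(1)] fold_Inl[OF l'(2)] fold_Inr[OF l'(2)]
        by (cases z) (auto simp: a'_def pad_shift_def)
    qed
  qed
  then show ?thesis using g that[of g a'] by (auto simp: a'_def)
qed

text \<open>The point \<open>y\<close> certifies that \<open>a_i^-1 (a_1 t) a_i\<close> moves
  \<open>f 0\<close>: the inverse of \<open>a_i\<close> leads from \<open>f 0\<close> to
  \<open>y\<close>, and \<open>a_1 t\<close> does not fix \<open>y\<close> because \<open>s\<close>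
  is the action of \<open>t^-1\<close>.\<close>

definition moving_action ::
    "(nat \<Rightarrow> nat list) \<Rightarrow> nat \<Rightarrow> nat \<Rightarrow> ('a \<Rightarrow> 'a) \<Rightarrow> (nat \<Rightarrow> 'a \<Rightarrow> 'a) \<Rightarrow> (int \<Rightarrow> 'a) \<Rightarrow> bool"
  where "moving_action w i j s a f \<longleftrightarrow>
    hydra_action w j s a f \<and> (\<exists>y. a i y = f 0 \<and> a 1 y \<noteq> s y)"

text \<open>Each extension step changes the type to \<open>padded\<close>; returning to the natural
  numbers keeps the induction over the letters inside one type.\<close>

lemma moving_action_nat:
  fixes f :: "int \<Rightarrow> 'a :: countable"
  assumes act: "moving_action w i j s a f"
  shows "\<exists>s' a' (f' :: int \<Rightarrow> nat). moving_action w i j s' a' f'"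
proof -
  have "inj f" using act by (simp add: moving_action_def hydra_action_def)
  then have "infinite (UNIV :: 'a set)"
    using finite_subset[OF subset_UNIV] finite_imageD infinite_UNIV_int by blast
  then obtain e :: "'a \<Rightarrow> nat" where e: "bij e"
    using to_nat_on_infinite[of "UNIV :: 'a set"] by auto
  obtain y where y: "a i y = f 0" "a 1 y \<noteq> s y" using act by (auto simp: moving_action_def)
  have inj: "inj e" using e by (rule bij_is_inj)
  have "hydra_action w j (e \<circ> s \<circ> inv_into UNIV e) (\<lambda>l. e \<circ> a l \<circ> inv_into UNIV e) (e \<circ> f)"
    using act e by (intro hydra_action_transport) (auto simp: moving_action_def)
  moreover have "(e \<circ> a i \<circ> inv_into UNIV e) (e y) = (e \<circ> f) 0"
    "(e \<circ> a 1 \<circ> inv_into UNIV e) (e y) \<noteq> (e \<circ> s \<circ> inv_into UNIV e) (e y)"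
    using inj y by (simp_all add: inj_eq)
  ultimately show ?thesis unfolding moving_action_def by blast
qed

text \<open>The induction starts at \<open>i\<close>, where the nonempty word makes the new line
  miss a point and so yields the witness. Later extensions keep it among the original
  points.\<close>

lemma moving_action_exists:
  assumes lower: "\<forall>l\<in>{1..k}. set (w l) \<subseteq> {1..<l}"
    and i: "i \<in> {1..k}" "w i \<noteq> []" and first: "\<And>l. l \<in> {1..<i} \<Longrightarrow> w l = []"
  shows "\<exists>s a (f :: int \<Rightarrow> nat). moving_action w i k s a f"
proof -
  have "\<exists>s a (f :: int \<Rightarrow> nat). moving_action w i j s a f" if "i \<le> j" "j \<le> k" for j
    using that
  proof (induction j rule: dec_induct)
    case base
    have "1 \<in> {1..k}" using i(1) by auto
    then have "set (w 1) \<subseteq> {1..<1}" using lower by blast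
    then have "w 1 = []" by simp
    then have "i \<noteq> 1" using i by metis
    then obtain j where j: "i = Suc j" "j \<ge> 1" using i(1) by (cases i) auto
    \<comment> \<open>All words below \<open>i\<close> are empty, so the earlier letters may all act
      on the integers as one translation.\<close>
    define s where "s n = n + 1" for n :: int
    have bij_s: "bij s" unfolding s_def by (rule o_bij[of "\<lambda>n. n - 1"]) auto
    have act: "hydra_action w j s (\<lambda>_. s) id"
      using first bij_s j unfolding hydra_action_def
      by (auto simp: s_def intro: exI[of _ "m + 1" for m])
    define q where "q = s \<circ> fold (\<lambda>_. s) (w (Suc j))"
    have fold_s: "fold (\<lambda>_. s) u n = n + int (length u)" for u :: "nat list" and n
      by (induction u arbitrary: n) (auto simp: s_def)
    have q: "q n = n + (1 + int (length (w i)))" for n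
      by (simp add: q_def fold_s j s_def)
    have lower': "\<forall>l\<in>{1..Suc j}. set (w l) \<subseteq> {1..<l}" using lower i j by auto
    obtain g and a' :: "nat \<Rightarrow> int padded \<Rightarrow> int padded" where
      g: "g 0 = id 1" "\<And>n. q (g n) = g (n + 1)"
      and act': "hydra_action w (Suc j) (pad_shift s s q) a' (Inl \<circ> id)"
      and a': "\<And>l. l \<noteq> Suc j \<Longrightarrow> a' l = map_sum s id" "a' (Suc j) = pad_conj True id g"
      using hydra_action_step[OF act lower' q_def] by metis
    let ?L = "1 + int (length (w i))"
    have g_val: "g n = 1 + ?L * n" for n
    proof (induction n rule: int_induct[where k = 0])
      case (step1 n)
      then show ?case using g(2)[of n] by (simp add: q algebra_simps)
    next
      case (step2 n)
      then show ?case using g(2)[of "n - 1"] by (simp add: q algebra_simps)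
    qed (use g in simp)
    \<comment> \<open>The line \<open>g\<close> passes through 1 with step at least 2, so it skips
      0.\<close>
    have "0 \<notin> range g"
    proof
      assume "0 \<in> range g"
      then obtain n where "1 + ?L * n = 0" using g_val by (metis rangeE)
      then have "?L * (- n) = 1" by simp
      then have "?L dvd 1" by (metis dvd_triv_left)
      then show False using i(2) by simp
    qed
    \<comment> \<open>As 0 is off \<open>g\<close>, the base point is refilled from the first copy
      tagged \<open>False\<close>. There \<open>a_1\<close> acts trivially, whereas the shift acts
      as \<open>q\<close> and moves every point.\<close>
    then have "a' i (Inr (False, 0, 0)) = (Inl \<circ> id) 0" by (simp add: a'(2) j)
    moreover have "a' 1 (Inr (False, 0, 0)) \<noteq> pad_shift s s q (Inr (False, 0, 0))"
      using a'(1)[of 1] j by (simp add: pad_shift_def q)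
    ultimately have "moving_action w i i (pad_shift s s q) a' (Inl \<circ> id)"
      using act' j unfolding moving_action_def by blast
    then show ?case by (rule moving_action_nat)
  next
    case (step j)
    then obtain s a and f :: "int \<Rightarrow> nat" where act: "moving_action w i j s a f" by auto
    then obtain y where y: "a i y = f 0" "a 1 y \<noteq> s y" and act0: "hydra_action w j s a f"
      by (auto simp: moving_action_def)
    have lower': "\<forall>l\<in>{1..Suc j}. set (w l) \<subseteq> {1..<l}" using lower step by auto
    define q where "q = s \<circ> fold a (w (Suc j))"
    obtain a' :: "nat \<Rightarrow> nat padded \<Rightarrow> nat padded" where
      act': "hydra_action w (Suc j) (pad_shift s s q) a' (Inl \<circ> f)"
      and a': "\<And>l. l \<noteq> Suc j \<Longrightarrow> a' l = map_sum (a l) id"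
      using hydra_action_step[OF act0 lower' q_def] by metis
    \<comment> \<open>Both \<open>i\<close> and 1 differ from \<open>Suc j\<close>, so these letters
      extend the old ones and the old witness survives.\<close>
    have "a' i (Inl y) = (Inl \<circ> f) 0" "a' 1 (Inl y) \<noteq> pad_shift s s q (Inl y)"
      using a'[of i] a'[of 1] y step i(1) by (auto simp: pad_shift_def)
    then have "moving_action w i (Suc j) (pad_shift s s q) a' (Inl \<circ> f)"
      using act' unfolding moving_action_def by blast
    then show ?case by (rule moving_action_nat)
  qed
  then show ?thesis using i(1) by auto
qed

section \<open>The action of the whole group, and necessity of empty words\<close>

context triangular_words
begin

text \<open>The given index only shows that some word is nonempty; the witness is formed with the
  least such index, as \<open>moving_action_exists\<close> requires.\<close>

lemma conj_elt_notin_Hk: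
  assumes "i \<in> {1..k}" "w i \<noteq> []"
  obtains i where "i \<in> {1..k}" "conj_elt (Gk k w) (Gk_gen k w) i \<notin> Hk k w"
proof -
  define i where "i = (LEAST i. i \<in> {1..k} \<and> w i \<noteq> [])"
  have i: "i \<in> {1..k}" "w i \<noteq> []"
    using LeastI[of "\<lambda>i. i \<in> {1..k} \<and> w i \<noteq> []", OF conjI[OF assms]] by (auto simp: i_def)
  have first: "w l = []" if "l \<in> {1..<i}" for l
    using not_less_Least[of l "\<lambda>i. i \<in> {1..k} \<and> w i \<noteq> []"] that i(1) by (auto simp: i_def)
  obtain s a and f :: "int \<Rightarrow> nat" and y where act: "hydra_action w k s a f"
    and y: "a i y = f 0" "a 1 y \<noteq> s y"
    using moving_action_exists[OF lower i first] by (auto simp: moving_action_def)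
  have s: "bij s" "\<And>n. s (f n) = f (n + 1)" using act by (auto simp: hydra_action_def)
  have a: "bij (a l)" "a l (f 0) = f 1" "\<And>y. a l (s y) = s (fold a (w l) (a l y))"
    if "l \<in> {1..k}" for l
    using act that by (auto simp: hydra_action_def)
  interpret P: group "perms :: (nat \<Rightarrow> nat) monoid" by (rule group_perms)
  let ?t = "inv_into UNIV s"
  have t: "bij ?t" "\<And>y. ?t (s y) = y" "\<And>y. s (?t y) = y"
    using s(1) by (auto simp: bij_imp_bij_inv bij_is_inj bij_is_surj surj_f_inv_f)
  define F where "F x = (case x of A l \<Rightarrow> a l | T \<Rightarrow> ?t)" for x
  have F: "F \<in> Gk_gens k \<rightarrow> carrier perms" using a(1) t(1) by (auto simp: F_def Gk_gens_def)
  have inv_t: "inv\<^bsub>perms\<^esub> ?t = s"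
    using s(1) t(1) by (simp add: inv_perms inv_inv_eq)
  have pos: "word_val perms F (positive_word u) = fold a u" for u
    by (induction u) (auto simp: F_def)
  \<comment> \<open>In the right action the relation reads: first \<open>s\<close>, then
    \<open>a_l\<close>, then the inverse of \<open>s\<close>. This is the last condition of
    \<open>hydra_action\<close>.\<close>
  have rel: "word_val perms F u = word_val perms F v" if "(u, v) \<in> Gk_rels k w" for u v
  proof -
    obtain l where l: "l \<in> {1..k}" "u = [Neg T, Pos (A l), Pos T]"
      "v = Pos (A l) # positive_word (w l)"
      using \<open>(u, v) \<in> Gk_rels k w\<close> by (auto simp: Gk_rels_def positive_word_def)
    show ?thesis
      unfolding l(2,3) word_val.simps pos
      using a(3)[OF l(1)] t(2) by (auto simp: F_def inv_t fun_eq_iff)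
  qed
  obtain \<Phi> where \<Phi>: "\<Phi> \<in> hom (Gk k w) perms"
    "\<And>u. u \<in> gwords (Gk_gens k) \<Longrightarrow> \<Phi> (pres_class (Gk_gens k) (Gk_rels k w) u) = word_val perms F u"
    using P.presented_group_hom[OF F rel] unfolding Gk_def by blast
  interpret G: group "Gk k w" by (rule group_Gk)
  interpret h: group_hom "Gk k w" perms \<Phi> by unfold_locales (rule \<Phi>(1))
  have gen: "\<Phi> (Gk_gen k w x) = F x" if "x \<in> Gk_gens k" for x
    using that \<Phi>(2)[of "[Pos x]"] by (simp add: Gk_gen_def)
  have gen_closed: "Gk_gen k w x \<in> carrier (Gk k w)" if "x \<in> Gk_gens k" for x
    using that Gk_gen_closed by auto
  \<comment> \<open>Each \<open>a_l t\<close> sends \<open>f 0\<close> to \<open>f 1\<close> and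
    back.\<close>
  have fix_H: "h \<in> carrier (Gk k w) \<and> \<Phi> h (f 0) = f 0" if "h \<in> Hk k w" for h
    using that unfolding Hk_def
  proof (induction rule: generate.induct)
    case (incl h)
    then obtain l where "l \<in> {1..k}" "h = Gk_gen k w (A l) \<otimes>\<^bsub>Gk k w\<^esub> Gk_gen k w T" by auto
    then show ?case using a(2) t(2)[of "f 0"] s(2)[of 0]
      by (simp add: gen gen_closed A_in_gens T_in_gens F_def)
  next
    case (inv h)
    then obtain l where l: "l \<in> {1..k}" "h = Gk_gen k w (A l) \<otimes>\<^bsub>Gk k w\<^esub> Gk_gen k w T" by auto
    then have h: "h \<in> carrier (Gk k w)" "\<Phi> h (f 0) = f 0" using a(2) t(2)[of "f 0"] s(2)[of 0]
      by (simp_all add: gen gen_closed A_in_gens T_in_gens F_def)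
    then have "bij (\<Phi> h)" using h.hom_closed by simp
    then show ?case using h by (simp add: inv_perms inv_f_eq bij_is_inj)
  next
    case (eng h1 h2)
    then show ?case by simp
  qed simp
  have one: "1 \<in> {1..k}" using i(1) by auto
  have "\<Phi> (conj_elt (Gk k w) (Gk_gen k w) i) (f 0) = conj_elt perms (\<lambda>x. \<Phi> (Gk_gen k w x)) i (f 0)"
    using hom_conj_elt[OF group_perms \<Phi>(1) i(1)] by simp
  also have "\<dots> = a i (?t (a 1 (inv_into UNIV (a i) (f 0))))"
    using i(1) one a(1)[OF i(1)]
    by (simp add: conj_elt_def gen A_in_gens T_in_gens F_def inv_perms)
  also have "inv_into UNIV (a i) (f 0) = y"
    using y(1) a(1)[OF i(1)] by (simp add: inv_f_eq bij_is_inj)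
  finally have "\<Phi> (conj_elt (Gk k w) (Gk_gen k w) i) (f 0) = a i (?t (a 1 y))" .
  moreover have "a i (?t (a 1 y)) \<noteq> f 0"
  proof
    assume "a i (?t (a 1 y)) = f 0"
    then have "?t (a 1 y) = y" using y(1) a(1)[OF i(1)] by (metis bij_is_inj inj_eq)
    then show False using y(2) t(3) by metis
  qed
  ultimately have "conj_elt (Gk k w) (Gk_gen k w) i \<notin> Hk k w" using fix_H by auto
  with i(1) show ?thesis by (rule that)
qed

text \<open>A separating finite quotient for the witness would contradict
  \<open>conj_elt_finite\<close>, applied with the image of \<open>Hk k w\<close> as
  \<open>S\<close>.\<close>

lemma separable_Hk_imp_trivial:
  assumes "separable_subgroup (Gk k w) (Hk k w)"
  shows "\<forall>i\<in>{1..k}. w i = []"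
proof (rule ccontr)
  assume "\<not> ?thesis"
  then obtain i where i: "i \<in> {1..k}" "conj_elt (Gk k w) (Gk_gen k w) i \<notin> Hk k w"
    using conj_elt_notin_Hk by blast
  then obtain Q :: "nat monoid" and \<phi> where Q: "group Q" "finite (carrier Q)"
    and \<phi>: "\<phi> \<in> epi (Gk k w) Q" "\<phi> (conj_elt (Gk k w) (Gk_gen k w) i) \<notin> \<phi> ` Hk k w"
    using assms conj_elt_closed[OF group_Gk Gk_gen_closed i(1)]
    unfolding separable_subgroup_def by blast
  interpret G: group "Gk k w" by (rule group_Gk)
  interpret Q: group Q by (rule Q)
  have hom: "\<phi> \<in> hom (Gk k w) Q" using \<phi>(1) by (simp add: epi_def)
  interpret h: group_hom "Gk k w" Q \<phi> by unfold_locales (rule hom)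
  have "conj_elt Q (\<lambda>x. \<phi> (Gk_gen k w x)) i \<in> \<phi> ` Hk k w"
  proof (rule conj_elt_finite[OF Q])
    show "subgroup (\<phi> ` Hk k w) Q" by (rule h.subgroup_img_is_subgroup[OF subgroup_Hk])
    show "(\<lambda>x. \<phi> (Gk_gen k w x)) \<in> Gk_gens k \<rightarrow> carrier Q"
      using Gk_gen_closed by (auto intro!: h.hom_closed)
    show "\<phi> (Gk_gen k w (A l)) \<otimes>\<^bsub>Q\<^esub> \<phi> (Gk_gen k w T) \<in> \<phi> ` Hk k w" if "l \<in> {1..k}" for l
    proof -
      have "Gk_gen k w (A l) \<in> carrier (Gk k w)" "Gk_gen k w T \<in> carrier (Gk k w)"
        using that Gk_gen_closed by (auto simp: Pi_iff A_in_gens T_in_gens)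
      then show ?thesis using gen_times_T_in_Hk[OF that] by (metis h.hom_mult imageI)
    qed
  qed (use hom_Gk_rel[OF Q(1) hom] i in auto)
  then show False using \<phi>(2) hom_conj_elt[OF Q(1) hom i(1)] by simp
qed

end

section \<open>Residually finite HNN extensions\<close>

text \<open>The left side, with its trailing unit, is the form into which \<open>word_val\<close>
  unfolds a commutator of two generators.\<close>

lemma (in group) commutator_word_eq_one:
  assumes "x \<in> carrier G" "y \<in> carrier G"
  shows "inv x \<otimes> (inv y \<otimes> (x \<otimes> (y \<otimes> \<one>))) = \<one> \<longleftrightarrow> x \<otimes> y = y \<otimes> x"
proof -
  have "inv x \<otimes> (inv y \<otimes> (x \<otimes> (y \<otimes> \<one>))) = inv (y \<otimes> x) \<otimes> (x \<otimes> y)"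
    using assms by (simp add: inv_mult_group m_assoc)
  also have "\<dots> = \<one> \<longleftrightarrow> x \<otimes> y = y \<otimes> x"
    using assms by (metis inv_closed inv_equality inv_inv l_inv m_closed)
  finally show ?thesis .
qed

text \<open>Sets that are not cosets are fixed, so that the result is a permutation of a whole type.
  The Boolean doubles the coset space to make room for \<open>coset_flip\<close>.\<close>

definition coset_shift :: "('a, 'm) monoid_scheme \<Rightarrow> 'a set \<Rightarrow> 'a \<Rightarrow> 'a set \<times> bool \<Rightarrow> 'a set \<times> bool"
  where "coset_shift G H x = (\<lambda>(S, b). (if S \<in> rcosets\<^bsub>G\<^esub> H then S #>\<^bsub>G\<^esub> x else S, b))"

text \<open>The action of the stable letter: it exchanges the two copies of the single coset
  \<open>H\<close>.\<close>

definition coset_flip :: "'a set \<Rightarrow> 'a set \<times> bool \<Rightarrow> 'a set \<times> bool"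
  where "coset_flip H = (\<lambda>(S, b). (S, if S = H then \<not> b else b))"

context
  fixes G :: "('a, 'm) monoid_scheme" (structure) and H
  assumes G: "group G" and H: "subgroup H G"
begin

interpretation group G by (rule G)
interpretation H: subgroup H G by (rule H)

lemma coset_subset: "S \<in> rcosets H \<Longrightarrow> S \<subseteq> carrier G"
  using H.rcosets_carrier[OF G] .

lemma coset_shift_in_rcosets:
  assumes "S \<in> rcosets H" "x \<in> carrier G"
  shows "S #> x \<in> rcosets H"
proof -
  obtain y where "y \<in> carrier G" "S = H #> y" using assms(1) by (auto simp: RCOSETS_def)
  then show ?thesis using assms(2) H.subset by (simp add: coset_mult_assoc rcosetsI)
qed

lemma coset_shift_mult:
  assumes "x \<in> carrier G" "y \<in> carrier G"
  shows "coset_shift G H (x \<otimes> y) = coset_shift G H y \<circ> coset_shift G H x"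
  using assms coset_shift_in_rcosets coset_subset
  by (auto simp: coset_shift_def fun_eq_iff coset_mult_assoc)

lemma coset_shift_one: "coset_shift G H \<one> = id"
  using coset_subset by (auto simp: coset_shift_def fun_eq_iff)

lemma bij_coset_shift:
  assumes "x \<in> carrier G"
  shows "bij (coset_shift G H x)"
proof (rule o_bij)
  show "coset_shift G H (inv x) \<circ> coset_shift G H x = id"
    "coset_shift G H x \<circ> coset_shift G H (inv x) = id"
    using assms by (simp_all flip: coset_shift_mult add: coset_shift_one)
qed

lemma bij_coset_flip: "bij (coset_flip H)"
  by (rule o_bij[of "coset_flip H"]) (auto simp: coset_flip_def fun_eq_iff)

lemma H_in_rcosets: "H \<in> rcosets H"
  using rcosetsI[OF H.subset one_closed] H.subset by simp

text \<open>At \<open>(H, False)\<close>, flipping first always changes the Boolean, but flipping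
  last does so only if \<open>x\<close> keeps \<open>H\<close> in place. Conversely, an element of
  \<open>H\<close> also keeps the other cosets away from \<open>H\<close>.\<close>

lemma flip_shift_commute:
  assumes x: "x \<in> carrier G"
  shows "coset_flip H \<circ> coset_shift G H x = coset_shift G H x \<circ> coset_flip H \<longleftrightarrow> x \<in> H"
proof
  assume "coset_flip H \<circ> coset_shift G H x = coset_shift G H x \<circ> coset_flip H"
  then have "coset_flip H (coset_shift G H x (H, False)) = coset_shift G H x (coset_flip H (H, False))"
    by (simp add: fun_eq_iff)
  then have "H #> x = H" using H_in_rcosets by (auto simp: coset_flip_def coset_shift_def split: if_splits)
  then show "x \<in> H" using x H by (metis coset_join1 H.subset)
next
  assume "x \<in> H"
  then have Hx: "H #> x = H" using x H by (simp add: coset_join2)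
  have "S #> x = H \<longleftrightarrow> S = H" if S: "S \<in> rcosets H" for S
  proof
    assume "S #> x = H"
    then have "S #> x #> inv x = H #> x #> inv x" using Hx by simp
    then show "S = H" using x S coset_subset H.subset by (simp add: coset_mult_assoc)
  qed (use Hx in simp)
  then show "coset_flip H \<circ> coset_shift G H x = coset_shift G H x \<circ> coset_flip H"
    using H_in_rcosets by (auto simp: coset_flip_def coset_shift_def fun_eq_iff)
qed

text \<open>
  If g lies outside H, the commutator of the stable letter with g is nontrivial, and it can survive
  only in finite quotients in which the image of g avoids the image of H.
\<close>

lemma residually_finite_hnn_imp_separable:
  assumes rf: "residually_finite (hnn_extension G H (\<lambda>h. h))"
  shows "separable_subgroup G H"
  unfolding separable_subgroup_def
proof (intro conjI ballI H)
  fix g assume g: "g \<in> carrier G - H"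
  define X where "X = Base ` carrier G \<union> {Stable}"
  define R where "R = {([Pos (Base g), Pos (Base h)], [Pos (Base (g \<otimes> h))]) | g h.
      g \<in> carrier G \<and> h \<in> carrier G} \<union>
    {([Neg Stable, Pos (Base a), Pos Stable], [Pos (Base a)]) | a. a \<in> H}"
  define \<Gamma> where "\<Gamma> = presented_group X R"
  have rf: "residually_finite \<Gamma>" using rf by (simp add: hnn_extension_def \<Gamma>_def X_def R_def)
  define c where "c = [Neg Stable, Neg (Base g), Pos Stable, Pos (Base g)]"
  have X: "Base x \<in> X \<longleftrightarrow> x \<in> carrier G" "Stable \<in> X" for x by (auto simp: X_def)
  have c: "c \<in> gwords X" using g by (simp add: c_def X)
  interpret \<Gamma>: group \<Gamma> unfolding \<Gamma>_def by (rule group_presented_group)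
  interpret P: group "perms :: ('a set \<times> bool \<Rightarrow> 'a set \<times> bool) monoid" by (rule group_perms)
  define F where "F y = (case y of Base x \<Rightarrow> coset_shift G H x | Stable \<Rightarrow> coset_flip H)" for y
  have F: "F \<in> X \<rightarrow> carrier perms"
    by (auto simp: F_def X_def bij_coset_shift bij_coset_flip)
  have rel: "word_val perms F u = word_val perms F v" if uv: "(u, v) \<in> R" for u v
  proof -
    consider (mult) x y where "x \<in> carrier G" "y \<in> carrier G"
        "u = [Pos (Base x), Pos (Base y)]" "v = [Pos (Base (x \<otimes> y))]"
      | (stable) h where "h \<in> H" "u = [Neg Stable, Pos (Base h), Pos Stable]" "v = [Pos (Base h)]"
      using uv by (auto simp: R_def)
    then show ?thesis
    proof cases
      case mult
      then show ?thesis by (simp add: F_def coset_shift_mult)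
    next
      case stable
      have "coset_flip H \<circ> coset_shift G H h = coset_shift G H h \<circ> coset_flip H"
        using stable(1) flip_shift_commute by simp
      moreover have "coset_flip H \<circ> inv_into UNIV (coset_flip H) = id"
        using bij_coset_flip by (auto simp: fun_eq_iff bij_is_surj surj_f_inv_f)
      ultimately show ?thesis
        unfolding stable by (simp add: F_def inv_perms bij_coset_flip o_assoc) (simp flip: o_assoc)
    qed
  qed
  obtain \<Phi> where \<Phi>: "\<Phi> \<in> hom \<Gamma> perms"
    "\<And>u. u \<in> gwords X \<Longrightarrow> \<Phi> (pres_class X R u) = word_val perms F u"
    using P.presented_group_hom[OF F rel] unfolding \<Gamma>_def by blast
  interpret \<Phi>: group_hom \<Gamma> perms \<Phi> by unfold_locales (rule \<Phi>(1))
  have "word_val perms F c \<noteq> \<one>\<^bsub>perms\<^esub>"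
    using P.commutator_word_eq_one[of "coset_flip H" "coset_shift G H g"] g flip_shift_commute[of g]
    by (simp add: c_def F_def bij_coset_flip bij_coset_shift)
  then have "pres_class X R c \<noteq> \<one>\<^bsub>\<Gamma>\<^esub>" using \<Phi>(2)[OF c] by fastforce
  moreover have cls: "pres_class X R u \<in> carrier \<Gamma>" if "u \<in> gwords X" for u
    using that by (simp add: \<Gamma>_def pres_class_closed)
  ultimately obtain Q :: "nat monoid" and \<phi> where Q: "group Q" "finite (carrier Q)"
    and \<phi>: "\<phi> \<in> epi \<Gamma> Q" "\<phi> (pres_class X R c) \<noteq> \<one>\<^bsub>Q\<^esub>"
    using rf c unfolding residually_finite_def by blast
  interpret Q: group Q by (rule Q)
  have hom: "\<phi> \<in> hom \<Gamma> Q" using \<phi>(1) by (simp add: epi_def)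
  interpret \<phi>: group_hom \<Gamma> Q \<phi> by unfold_locales (rule hom)
  define \<gamma> where "\<gamma> = (\<lambda>y. pres_class X R [Pos y])"
  have \<gamma>: "\<gamma> \<in> X \<rightarrow> carrier \<Gamma>" using cls by (auto simp: \<gamma>_def)
  have val: "\<phi> (pres_class X R u) = word_val Q (\<lambda>y. \<phi> (\<gamma> y)) u" if "u \<in> gwords X" for u
    using hom_word_val[OF \<Gamma>.is_group Q(1) hom \<gamma> that] word_val_presented_group[OF that, of R]
    by (simp add: \<Gamma>_def \<gamma>_def)
  \<comment> \<open>The composite of the natural map from \<open>G\<close> to
    \<open>\<Gamma>\<close> with \<open>\<phi>\<close>; it is multiplicative because the
    multiplication table of \<open>G\<close> is among the relations.\<close>
  define \<psi> where "\<psi> x = \<phi> (\<gamma> (Base x))" for x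
  have \<psi>_closed: "\<psi> x \<in> carrier Q" if "x \<in> carrier G" for x
    using that \<gamma> by (auto simp: \<psi>_def X intro!: \<phi>.hom_closed)
  have p_closed: "\<phi> (\<gamma> Stable) \<in> carrier Q" using \<gamma> X by (auto intro!: \<phi>.hom_closed)
  have \<psi>: "\<psi> \<in> hom G Q"
  proof (rule homI)
    fix x y assume xy: "x \<in> carrier G" "y \<in> carrier G"
    then have "pres_class X R [Pos (Base x), Pos (Base y)] = pres_class X R [Pos (Base (x \<otimes> y))]"
      by (intro pres_class_rel) (auto simp: R_def X)
    then show "\<psi> (x \<otimes> y) = \<psi> x \<otimes>\<^bsub>Q\<^esub> \<psi> y"
      using xy val[of "[Pos (Base x), Pos (Base y)]"] val[of "[Pos (Base (x \<otimes> y))]"] \<psi>_closed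
      by (simp add: X \<psi>_def)
  qed (rule \<psi>_closed)
  interpret \<psi>: group_hom G Q \<psi> by unfold_locales (rule \<psi>)
  have "\<phi> (\<gamma> Stable) \<otimes>\<^bsub>Q\<^esub> \<psi> h = \<psi> h \<otimes>\<^bsub>Q\<^esub> \<phi> (\<gamma> Stable)" if h: "h \<in> H" for h
  proof -
    have "pres_class X R [Neg Stable, Pos (Base h), Pos Stable] = pres_class X R [Pos (Base h)]"
      using h by (intro pres_class_rel) (auto simp: R_def X)
    then have "inv\<^bsub>Q\<^esub> \<phi> (\<gamma> Stable) \<otimes>\<^bsub>Q\<^esub> (\<psi> h \<otimes>\<^bsub>Q\<^esub> \<phi> (\<gamma> Stable)) = \<psi> h"
      using h val[of "[Neg Stable, Pos (Base h), Pos Stable]"] val[of "[Pos (Base h)]"] \<psi>_closed[of h]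
        p_closed by (simp add: X \<psi>_def)
    then show ?thesis using \<psi>_closed[of h] p_closed h
      by (metis Q.inv_solve_left Q.m_closed H.mem_carrier)
  qed
  moreover have "\<phi> (\<gamma> Stable) \<otimes>\<^bsub>Q\<^esub> \<psi> g \<noteq> \<psi> g \<otimes>\<^bsub>Q\<^esub> \<phi> (\<gamma> Stable)"
    using \<phi>(2) val[OF c] Q.commutator_word_eq_one[OF p_closed \<psi>_closed[of g]] g
    by (simp add: c_def \<psi>_def)
  \<comment> \<open>The image of an element of \<open>H\<close> commutes with that of the stable
    letter, and the image of \<open>g\<close> does not.\<close>
  ultimately have avoid: "\<psi> g \<notin> \<psi> ` H" by auto
  \<comment> \<open>Although \<open>\<phi>\<close> is onto \<open>Q\<close>, the map
    \<open>\<psi>\<close> may miss elements, so the quotient is cut down to its image.\<close>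
  define Q' where "Q' = Q\<lparr>carrier := \<psi> ` carrier G\<rparr>"
  have "group Q'"
    unfolding Q'_def by (rule Q.subgroup_imp_group[OF \<psi>.img_is_subgroup])
  moreover have "carrier Q' \<subseteq> carrier Q" using \<psi>_closed by (auto simp: Q'_def)
  then have "finite (carrier Q')" using Q(2) finite_subset by blast
  moreover have "\<psi> \<in> epi G Q'" using \<psi> by (auto simp: epi_def hom_def Q'_def)
  ultimately show "\<exists>(Q :: nat monoid) \<phi>. group Q \<and> finite (carrier Q) \<and> \<phi> \<in> epi G Q \<and> \<phi> g \<notin> \<phi> ` H"
    using avoid by blast
qed

end

section \<open>Empty words\<close>

lemma (in group) word_val_commute:
  assumes "u \<in> gwords X" "f \<in> X \<rightarrow> carrier G" "t \<in> carrier G"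
    and comm: "\<And>x. x \<in> X \<Longrightarrow> t \<otimes> f x = f x \<otimes> t"
  shows "t \<otimes> word_val G f u = word_val G f u \<otimes> t"
  using assms(1)
proof (induction rule: gwords_induct)
  case Nil
  then show ?case using assms(3) by simp
next
  case (Pos x u)
  then have c: "f x \<in> carrier G" "word_val G f u \<in> carrier G"
    using assms(2) word_val_closed[of u X f] by auto
  have "t \<otimes> (f x \<otimes> word_val G f u) = f x \<otimes> (t \<otimes> word_val G f u)"
    using c assms(3) comm[OF Pos(1)] by (simp flip: m_assoc)
  then show ?case using Pos.IH c assms(3) by (simp add: m_assoc)
next
  case (Neg x u)
  then have c: "f x \<in> carrier G" "word_val G f u \<in> carrier G"
    using assms(2) word_val_closed[of u X f] by auto
  have "t \<otimes> inv f x = inv f x \<otimes> t"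
    using c(1) assms(3) comm[OF Neg(1)] by (metis inv_closed inv_solve_left inv_solve_right m_assoc m_closed)
  then have "t \<otimes> (inv f x \<otimes> word_val G f u) = inv f x \<otimes> (t \<otimes> word_val G f u)"
    using c assms(3) by (simp flip: m_assoc)
  then show ?case using Neg.IH c assms(3) by (simp add: m_assoc)
qed

lemma (in group) word_val_cong:
  assumes "u \<in> gwords X" "\<And>x. x \<in> X \<Longrightarrow> f x = g x"
  shows "word_val G f u = word_val G g u"
  using assms(1) by (induction rule: gwords_induct) (auto simp: assms(2))

section \<open>The case of a central \<open>t\<close>\<close>

locale trivial_words = triangular_words +
  assumes trivial: "\<forall>i\<in>{1..k}. w i = []"
begin

sublocale G: group "Gk k w" by (rule group_Gk)

abbreviation (input) t where "t \<equiv> Gk_gen k w T"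

lemma gen_closed: "x \<in> Gk_gens k \<Longrightarrow> Gk_gen k w x \<in> carrier (Gk k w)"
  using Gk_gen_closed by auto

lemma t_closed: "t \<in> carrier (Gk k w)"
  by (simp add: gen_closed T_in_gens)

lemma trivial_rels:
  assumes "(u, v) \<in> Gk_rels k w"
  obtains i where "i \<in> {1..k}" "u = [Neg T, Pos (A i), Pos T]" "v = [Pos (A i)]"
  using assms trivial by (auto simp: Gk_rels_def)

text \<open>With empty words the relations only say that \<open>t\<close> commutes with every
  \<open>a_i\<close>.\<close>

lemma Gk_hom:
  assumes "group K" "f \<in> Gk_gens k \<rightarrow> carrier K"
    and comm: "\<And>i. i \<in> {1..k} \<Longrightarrow> f (A i) \<otimes>\<^bsub>K\<^esub> f T = f T \<otimes>\<^bsub>K\<^esub> f (A i)"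
  obtains \<Phi> where "\<Phi> \<in> hom (Gk k w) K" "\<And>x. x \<in> Gk_gens k \<Longrightarrow> \<Phi> (Gk_gen k w x) = f x"
proof -
  interpret K: group K by fact
  have rel: "word_val K f u = word_val K f v" if uv: "(u, v) \<in> Gk_rels k w" for u v
  proof -
    obtain i where i: "i \<in> {1..k}" "u = [Neg T, Pos (A i), Pos T]" "v = [Pos (A i)]"
      using uv trivial_rels by blast
    have "f (A i) \<in> carrier K" "f T \<in> carrier K"
      using assms(2) i(1) by (auto simp: Pi_iff A_in_gens T_in_gens)
    then show ?thesis using comm[OF i(1)] i by (simp flip: K.m_assoc)
  qed
  obtain \<Phi> where \<Phi>: "\<Phi> \<in> hom (Gk k w) K"
    "\<And>u. u \<in> gwords (Gk_gens k) \<Longrightarrow> \<Phi> (pres_class (Gk_gens k) (Gk_rels k w) u) = word_val K f u"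
    using K.presented_group_hom[OF assms(2) rel] unfolding Gk_def by blast
  have "\<Phi> (Gk_gen k w x) = f x" if "x \<in> Gk_gens k" for x
  proof -
    have "f x \<in> carrier K" using assms(2) that by auto
    then show ?thesis using \<Phi>(2)[of "[Pos x]"] that by (simp add: Gk_gen_def)
  qed
  then show ?thesis using \<Phi>(1) that by blast
qed

lemma Gk_word_val:
  assumes "g \<in> carrier (Gk k w)"
  obtains u where "u \<in> gwords (Gk_gens k)" "g = word_val (Gk k w) (Gk_gen k w) u"
  using assms word_val_presented_group[of _ "Gk_gens k" "Gk_rels k w"]
  by (auto simp: Gk_def carrier_presented_group Gk_gen_def[abs_def])

lemma t_commute_gen:
  assumes "x \<in> Gk_gens k"
  shows "t \<otimes>\<^bsub>Gk k w\<^esub> Gk_gen k w x = Gk_gen k w x \<otimes>\<^bsub>Gk k w\<^esub> t"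
proof (cases x)
  case (A i)
  then have i: "i \<in> {1..k}" using assms by (simp add: A_in_gens)
  then have "([Neg T, Pos (A i), Pos T], [Pos (A i)]) \<in> Gk_rels k w"
    using trivial by (force simp: Gk_rels_def)
  from Gk_rel[OF this]
  have "inv\<^bsub>Gk k w\<^esub> t \<otimes>\<^bsub>Gk k w\<^esub> (Gk_gen k w x \<otimes>\<^bsub>Gk k w\<^esub> t) = Gk_gen k w x"
    using gen_closed[OF assms] t_closed A by simp
  then show ?thesis
    using gen_closed[OF assms] t_closed by (metis G.inv_solve_left G.m_closed)
qed simp

lemma t_central:
  assumes "g \<in> carrier (Gk k w)"
  shows "t \<otimes>\<^bsub>Gk k w\<^esub> g = g \<otimes>\<^bsub>Gk k w\<^esub> t"
  using Gk_word_val[OF assms] G.word_val_commute[OF _ Gk_gen_closed t_closed t_commute_gen] by metis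

lemma t_pow_central:
  assumes "g \<in> carrier (Gk k w)"
  shows "t [^]\<^bsub>Gk k w\<^esub> (n :: int) \<otimes>\<^bsub>Gk k w\<^esub> g = g \<otimes>\<^bsub>Gk k w\<^esub> t [^]\<^bsub>Gk k w\<^esub> n"
proof (induction n rule: int_induct[where k = 0])
  case (step1 n)
  have "t [^]\<^bsub>Gk k w\<^esub> (n + 1) = t [^]\<^bsub>Gk k w\<^esub> n \<otimes>\<^bsub>Gk k w\<^esub> t"
    using t_closed by (simp add: G.int_pow_mult)
  then show ?case using step1 assms t_closed t_central[OF assms]
    by (metis G.int_pow_closed G.m_assoc)
next
  case (step2 n)
  let ?T = "t [^]\<^bsub>Gk k w\<^esub> (n - 1)"
  have n: "t [^]\<^bsub>Gk k w\<^esub> n = t \<otimes>\<^bsub>Gk k w\<^esub> ?T"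
    using t_closed G.int_pow_mult[of t 1 "n - 1"] by simp
  have "t \<otimes>\<^bsub>Gk k w\<^esub> (?T \<otimes>\<^bsub>Gk k w\<^esub> g) = t \<otimes>\<^bsub>Gk k w\<^esub> (g \<otimes>\<^bsub>Gk k w\<^esub> ?T)"
    using step2(2) n assms t_closed t_central[OF assms] by (metis G.int_pow_closed G.m_assoc)
  then show ?case using assms t_closed by simp
qed (use assms in simp)

text \<open>The signs are chosen to give every \<open>a_i t\<close> height zero.\<close>

lemma height_hom:
  obtains \<rho> where "\<rho> \<in> hom (Gk k w) integer_group" "\<rho> t = 1"
    "\<And>i. i \<in> {1..k} \<Longrightarrow> \<rho> (Gk_gen k w (A i)) = - 1"
proof -
  define f where "f x = (case x of A i \<Rightarrow> - 1 | T \<Rightarrow> (1 :: int))" for x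
  show ?thesis
    by (rule Gk_hom[of integer_group f])
      (auto simp: f_def A_in_gens T_in_gens intro: that)
qed

text \<open>As \<open>t\<close> is central, this form is preserved by products, and
  \<open>a_i = (a_i t) t^-1\<close> supplies the generators. For height zero it shows that the
  kernel of \<open>\<rho>\<close> lies in \<open>Hk k w\<close>.\<close>

lemma Hk_times_t_pow:
  assumes \<rho>: "\<rho> \<in> hom (Gk k w) integer_group" "\<rho> t = 1"
      "\<And>i. i \<in> {1..k} \<Longrightarrow> \<rho> (Gk_gen k w (A i)) = - 1"
    and g: "g \<in> carrier (Gk k w)"
  shows "\<exists>h\<in>Hk k w. g = h \<otimes>\<^bsub>Gk k w\<^esub> t [^]\<^bsub>Gk k w\<^esub> \<rho> g"
proof -
  interpret Z: group integer_group by simp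
  interpret \<rho>: group_hom "Gk k w" integer_group \<rho> by unfold_locales (rule \<rho>(1))
  interpret H: subgroup "Hk k w" "Gk k w" by (rule subgroup_Hk)
  note assoc = G.m_assoc
  have split: "t [^]\<^bsub>Gk k w\<^esub> (m + n) = t [^]\<^bsub>Gk k w\<^esub> m \<otimes>\<^bsub>Gk k w\<^esub> t [^]\<^bsub>Gk k w\<^esub> n" for m n :: int
    using t_closed by (simp add: G.int_pow_mult)
  have step: "\<exists>h\<in>Hk k w. x \<otimes>\<^bsub>Gk k w\<^esub> y = h \<otimes>\<^bsub>Gk k w\<^esub> t [^]\<^bsub>Gk k w\<^esub> \<rho> (x \<otimes>\<^bsub>Gk k w\<^esub> y)"
    if x: "x \<in> carrier (Gk k w)" "\<exists>h\<in>Hk k w. x = h \<otimes>\<^bsub>Gk k w\<^esub> t [^]\<^bsub>Gk k w\<^esub> \<rho> x"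
      and y: "y \<in> carrier (Gk k w)" "\<exists>h\<in>Hk k w. y = h \<otimes>\<^bsub>Gk k w\<^esub> t [^]\<^bsub>Gk k w\<^esub> \<rho> y" for x y
  proof -
    obtain h h' where h: "h \<in> Hk k w" "x = h \<otimes>\<^bsub>Gk k w\<^esub> t [^]\<^bsub>Gk k w\<^esub> \<rho> x"
      "h' \<in> Hk k w" "y = h' \<otimes>\<^bsub>Gk k w\<^esub> t [^]\<^bsub>Gk k w\<^esub> \<rho> y" using x y by blast
    let ?m = "t [^]\<^bsub>Gk k w\<^esub> \<rho> x" and ?n = "t [^]\<^bsub>Gk k w\<^esub> \<rho> y"
    have c: "h \<in> carrier (Gk k w)" "h' \<in> carrier (Gk k w)"
      "?m \<in> carrier (Gk k w)" "?n \<in> carrier (Gk k w)"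
      using h t_closed by auto
    have "x \<otimes>\<^bsub>Gk k w\<^esub> y = h \<otimes>\<^bsub>Gk k w\<^esub> ?m \<otimes>\<^bsub>Gk k w\<^esub> (h' \<otimes>\<^bsub>Gk k w\<^esub> ?n)" using h by metis
    also have "\<dots> = h \<otimes>\<^bsub>Gk k w\<^esub> (?m \<otimes>\<^bsub>Gk k w\<^esub> h') \<otimes>\<^bsub>Gk k w\<^esub> ?n" using c by (simp add: assoc)
    also have "\<dots> = (h \<otimes>\<^bsub>Gk k w\<^esub> h') \<otimes>\<^bsub>Gk k w\<^esub> (?m \<otimes>\<^bsub>Gk k w\<^esub> ?n)"
      using c t_pow_central[of h'] by (simp add: assoc)
    also have "?m \<otimes>\<^bsub>Gk k w\<^esub> ?n = t [^]\<^bsub>Gk k w\<^esub> \<rho> (x \<otimes>\<^bsub>Gk k w\<^esub> y)"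
      using x(1) y(1) by (simp add: split)
    finally show ?thesis using h by blast
  qed
  have gen: "\<exists>h\<in>Hk k w. x = h \<otimes>\<^bsub>Gk k w\<^esub> t [^]\<^bsub>Gk k w\<^esub> \<rho> x"
    "\<exists>h\<in>Hk k w. inv\<^bsub>Gk k w\<^esub> x = h \<otimes>\<^bsub>Gk k w\<^esub> t [^]\<^bsub>Gk k w\<^esub> \<rho> (inv\<^bsub>Gk k w\<^esub> x)"
    if x: "x = Gk_gen k w y" "y \<in> Gk_gens k" for x y
  proof -
    consider "y = T" | i where "y = A i" "i \<in> {1..k}" using x(2) by (auto simp: Gk_gens_def)
    then show "\<exists>h\<in>Hk k w. x = h \<otimes>\<^bsub>Gk k w\<^esub> t [^]\<^bsub>Gk k w\<^esub> \<rho> x"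
      "\<exists>h\<in>Hk k w. inv\<^bsub>Gk k w\<^esub> x = h \<otimes>\<^bsub>Gk k w\<^esub> t [^]\<^bsub>Gk k w\<^esub> \<rho> (inv\<^bsub>Gk k w\<^esub> x)"
    proof (atomize (full), cases)
      case 1
      have "x = \<one>\<^bsub>Gk k w\<^esub> \<otimes>\<^bsub>Gk k w\<^esub> t [^]\<^bsub>Gk k w\<^esub> \<rho> x"
        "inv\<^bsub>Gk k w\<^esub> x = \<one>\<^bsub>Gk k w\<^esub> \<otimes>\<^bsub>Gk k w\<^esub> t [^]\<^bsub>Gk k w\<^esub> \<rho> (inv\<^bsub>Gk k w\<^esub> x)"
        using x 1 \<rho>(2) t_closed by (simp_all add: G.int_pow_neg)
      then show "(\<exists>h\<in>Hk k w. x = h \<otimes>\<^bsub>Gk k w\<^esub> t [^]\<^bsub>Gk k w\<^esub> \<rho> x) \<and>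
        (\<exists>h\<in>Hk k w. inv\<^bsub>Gk k w\<^esub> x = h \<otimes>\<^bsub>Gk k w\<^esub> t [^]\<^bsub>Gk k w\<^esub> \<rho> (inv\<^bsub>Gk k w\<^esub> x))"
        using H.one_closed by blast
    next
      case 2
      have xc: "x \<in> carrier (Gk k w)" using x gen_closed by simp
      have xt: "x \<otimes>\<^bsub>Gk k w\<^esub> t \<in> Hk k w" using gen_times_T_in_Hk 2 x by simp
      have "x = (x \<otimes>\<^bsub>Gk k w\<^esub> t) \<otimes>\<^bsub>Gk k w\<^esub> t [^]\<^bsub>Gk k w\<^esub> \<rho> x"
        using xc t_closed \<rho>(3) 2 x by (simp add: G.int_pow_neg assoc)
      moreover have "inv\<^bsub>Gk k w\<^esub> x = inv\<^bsub>Gk k w\<^esub> (x \<otimes>\<^bsub>Gk k w\<^esub> t) \<otimes>\<^bsub>Gk k w\<^esub>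
          t [^]\<^bsub>Gk k w\<^esub> \<rho> (inv\<^bsub>Gk k w\<^esub> x)"
        using xc t_closed \<rho>(3) 2 x t_central[OF xc, symmetric]
        by (simp add: G.inv_mult_group assoc)
      ultimately show "(\<exists>h\<in>Hk k w. x = h \<otimes>\<^bsub>Gk k w\<^esub> t [^]\<^bsub>Gk k w\<^esub> \<rho> x) \<and>
        (\<exists>h\<in>Hk k w. inv\<^bsub>Gk k w\<^esub> x = h \<otimes>\<^bsub>Gk k w\<^esub> t [^]\<^bsub>Gk k w\<^esub> \<rho> (inv\<^bsub>Gk k w\<^esub> x))"
        using xt H.m_inv_closed by blast
    qed
  qed
  obtain u where u: "u \<in> gwords (Gk_gens k)" "g = word_val (Gk k w) (Gk_gen k w) u"
    using Gk_word_val[OF g] .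
  show ?thesis
    unfolding u(2) using u(1)
  proof (induction rule: gwords_induct)
    case Nil
    then show ?case by (auto intro!: bexI[of _ "\<one>\<^bsub>Gk k w\<^esub>"])
  next
    case (Pos x u)
    then show ?case
      using step[OF _ gen(1)[OF HOL.refl Pos(1)] G.word_val_closed[OF Pos(2) Gk_gen_closed]] gen_closed
      by simp
  next
    case (Neg x u)
    then show ?case
      using step[OF _ gen(2)[OF HOL.refl Neg(1)] G.word_val_closed[OF Neg(2) Gk_gen_closed]] gen_closed
      by simp
  qed
qed

lemma separable_Hk: "separable_subgroup (Gk k w) (Hk k w)"
  unfolding separable_subgroup_def
proof (intro conjI ballI subgroup_Hk)
  fix g assume g: "g \<in> carrier (Gk k w) - Hk k w"
  obtain \<rho> where \<rho>: "\<rho> \<in> hom (Gk k w) integer_group" "\<rho> t = 1"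
    "\<And>i. i \<in> {1..k} \<Longrightarrow> \<rho> (Gk_gen k w (A i)) = - 1" using height_hom by blast
  interpret Z: group integer_group by simp
  interpret \<rho>: group_hom "Gk k w" integer_group \<rho> by unfold_locales (rule \<rho>(1))
  interpret H: subgroup "Hk k w" "Gk k w" by (rule subgroup_Hk)
  have zero: "\<rho> h = 0" if "h \<in> Hk k w" for h
  proof -
    have "h \<in> carrier (Gk k w) \<and> \<rho> h = 0"
      using that unfolding Hk_def
      by (induction rule: generate.induct)
        (auto simp: \<rho>(2,3) gen_closed t_closed A_in_gens)
    then show ?thesis ..
  qed
  obtain h where "h \<in> Hk k w" "g = h \<otimes>\<^bsub>Gk k w\<^esub> t [^]\<^bsub>Gk k w\<^esub> \<rho> g"
    using Hk_times_t_pow[OF \<rho>] g by blast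
  then have nz: "\<rho> g \<noteq> 0" using g by (auto dest: H.mem_carrier)
  \<comment> \<open>The modulus exceeds the absolute value of the nonzero height of
    \<open>g\<close>, so it cannot divide that height.\<close>
  define N where "N = nat \<bar>\<rho> g\<bar> + 1"
  have N: "N \<noteq> 0" "int N = \<bar>\<rho> g\<bar> + 1" by (simp_all add: N_def)
  define Q where "Q = integer_mod_group N"
  define \<phi> where "\<phi> x = \<rho> x mod int N" for x
  have carrier_Q: "carrier Q = {0..<int N}" using N(1) by (simp add: Q_def carrier_integer_mod_group)
  have "\<phi> \<in> hom (Gk k w) Q"
    using N(1) by (intro homI) (auto simp: carrier_Q \<phi>_def, simp_all add: Q_def mod_add_eq)
  moreover have "\<phi> ` carrier (Gk k w) = carrier Q"
  proof
    show "\<phi> ` carrier (Gk k w) \<subseteq> carrier Q" using N(1) by (auto simp: carrier_Q \<phi>_def)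
    show "carrier Q \<subseteq> \<phi> ` carrier (Gk k w)"
    proof
      fix n assume "n \<in> carrier Q"
      then have "n = \<phi> (t [^]\<^bsub>Gk k w\<^esub> n)"
        using t_closed \<rho>(2) by (simp add: \<phi>_def \<rho>.hom_int_pow carrier_Q)
      then show "n \<in> \<phi> ` carrier (Gk k w)" using t_closed by blast
    qed
  qed
  ultimately have epi: "\<phi> \<in> epi (Gk k w) Q" by (simp add: epi_def)
  have nz': "\<phi> g \<noteq> 0"
  proof
    assume "\<phi> g = 0"
    then have "int N dvd \<rho> g" by (auto simp: \<phi>_def)
    then show False using nz N(2) zdvd_imp_le[of "int N" "\<bar>\<rho> g\<bar>"] by simp
  qed
  have "finite (carrier Q)" by (simp add: carrier_Q)
  moreover have "group Q" by (simp add: Q_def)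
  \<comment> \<open>Separability asks for quotients with natural numbers as elements, whereas
    \<open>Q\<close> consists of integers.\<close>
  ultimately obtain Q' :: "nat monoid" and \<psi> where Q': "group Q'" "finite (carrier Q')" "\<psi> \<in> epi (Gk k w) Q'"
    and \<psi>: "\<forall>x\<in>carrier (Gk k w). \<forall>y\<in>carrier (Gk k w). \<psi> x = \<psi> y \<longleftrightarrow> \<phi> x = \<phi> y"
    using finite_quotient_nat[of Q \<phi> "Gk k w"] epi by blast
  have "\<phi> g \<noteq> \<phi> h" if "h \<in> Hk k w" for h using that nz' zero by (simp add: \<phi>_def)
  then have "\<psi> g \<notin> \<psi> ` Hk k w" using \<psi> g by (auto dest: H.mem_carrier)
  then show "\<exists>(Q :: nat monoid) \<phi>. group Q \<and> finite (carrier Q) \<and> \<phi> \<in> epi (Gk k w) Q \<and>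
      \<phi> g \<notin> \<phi> ` Hk k w"
    using Q' by blast
qed

text \<open>Universal properties give homomorphisms in both directions; centrality of
  \<open>t\<close> makes the backward one multiplicative. That they are mutually inverse is checked
  on generators and on the two factors.\<close>

lemma iso_free_times_integers:
  "\<exists>\<phi> \<in> iso (Gk k w) (free_group {1..k} \<times>\<times> integer_group).
    (\<forall>i\<in>{1..k}. \<phi> (Gk_gen k w (A i)) = (pres_class {1..k} {} [Pos i], 0)) \<and>
    \<phi> (Gk_gen k w T) = (\<one>\<^bsub>free_group {1..k}\<^esub>, 1)"
proof -
  define X where "X = {1..k}"
  have A_in_gens: "A i \<in> Gk_gens k \<longleftrightarrow> i \<in> X" and gens: "Gk_gens k = A ` X \<union> {T}" for i
    by (auto simp: X_def Gk_gens_def)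
  let ?F = "free_group X" and ?K = "free_group X \<times>\<times> integer_group"
  let ?c = "\<lambda>i. pres_class X {} [Pos i]"
  interpret F: group ?F by (rule group_presented_group)
  interpret Z: group integer_group by simp
  interpret K: group ?K by (rule DirProd_group[OF F.is_group Z.is_group])
  have c: "?c i \<in> carrier ?F" if "i \<in> X" for i using that by (simp add: pres_class_closed)
  define f where "f x = (case x of A i \<Rightarrow> (?c i, 0) | T \<Rightarrow> (\<one>\<^bsub>?F\<^esub>, 1 :: int))" for x
  have f: "f \<in> Gk_gens k \<rightarrow> carrier ?K" using c by (auto simp: f_def gens)
  have comm: "f (A i) \<otimes>\<^bsub>?K\<^esub> f T = f T \<otimes>\<^bsub>?K\<^esub> f (A i)" if "i \<in> {1..k}" for i
    using c[of i] that[folded X_def] by (simp add: f_def)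
  obtain \<Phi> where \<Phi>: "\<Phi> \<in> hom (Gk k w) ?K" and gen: "\<And>x. x \<in> Gk_gens k \<Longrightarrow> \<Phi> (Gk_gen k w x) = f x"
    using Gk_hom[OF K.is_group f comm] by blast
  interpret \<Phi>: group_hom "Gk k w" ?K \<Phi> by unfold_locales (rule \<Phi>)
  have gA: "(\<lambda>i. Gk_gen k w (A i)) \<in> X \<rightarrow> carrier (Gk k w)"
    by (auto simp: gen_closed A_in_gens)
  obtain \<Psi>0 where \<Psi>0: "\<Psi>0 \<in> hom ?F (Gk k w)"
    "\<And>u. u \<in> gwords X \<Longrightarrow>
      \<Psi>0 (pres_class X {} u) = word_val (Gk k w) (\<lambda>i. Gk_gen k w (A i)) u"
    using G.presented_group_hom[OF gA, of "{}"] by blast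
  interpret \<Psi>0: group_hom ?F "Gk k w" \<Psi>0 by unfold_locales (rule \<Psi>0)
  define \<Psi> where "\<Psi> p = \<Psi>0 (fst p) \<otimes>\<^bsub>Gk k w\<^esub> t [^]\<^bsub>Gk k w\<^esub> snd p" for p :: "_ \<times> int"
  have \<Psi>: "\<Psi> \<in> hom ?K (Gk k w)"
  proof (rule homI)
    fix p q assume "p \<in> carrier ?K" "q \<in> carrier ?K"
    then obtain x m y n where p: "p = (x, m)" "q = (y, n)" "x \<in> carrier ?F" "y \<in> carrier ?F"
      by auto
    have "\<Psi> (p \<otimes>\<^bsub>?K\<^esub> q) = \<Psi>0 x \<otimes>\<^bsub>Gk k w\<^esub> (\<Psi>0 y \<otimes>\<^bsub>Gk k w\<^esub> t [^]\<^bsub>Gk k w\<^esub> m) \<otimes>\<^bsub>Gk k w\<^esub> t [^]\<^bsub>Gk k w\<^esub> n"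
      using p t_closed by (simp add: \<Psi>_def G.int_pow_mult G.m_assoc)
    then show "\<Psi> (p \<otimes>\<^bsub>?K\<^esub> q) = \<Psi> p \<otimes>\<^bsub>Gk k w\<^esub> \<Psi> q"
      using p t_closed t_pow_central[of "\<Psi>0 y" m, symmetric] by (simp add: \<Psi>_def G.m_assoc)
  qed (use t_closed in \<open>auto simp: \<Psi>_def\<close>)
  have \<Psi>_gen: "\<Psi> (\<Phi> (Gk_gen k w x)) = Gk_gen k w x" if x: "x \<in> Gk_gens k" for x
  proof -
    have "\<Psi>0 (?c i) = Gk_gen k w (A i)" if "i \<in> X" for i
      using \<Psi>0(2)[of "[Pos i]"] that gen_closed[of "A i"] by (simp add: A_in_gens)
    then show ?thesis
      using x t_closed gen_closed by (cases x) (auto simp: gen f_def \<Psi>_def A_in_gens)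
  qed
  have comp: "\<Psi> \<circ> \<Phi> \<in> hom (Gk k w) (Gk k w)" using hom_compose[OF \<Phi> \<Psi>] .
  have left: "\<Psi> (\<Phi> g) = g" if g: "g \<in> carrier (Gk k w)" for g
  proof -
    obtain u where u: "u \<in> gwords (Gk_gens k)" "g = word_val (Gk k w) (Gk_gen k w) u"
      using Gk_word_val[OF g] .
    have "(\<Psi> \<circ> \<Phi>) g = word_val (Gk k w) (\<lambda>x. (\<Psi> \<circ> \<Phi>) (Gk_gen k w x)) u"
      unfolding u(2) by (rule hom_word_val[OF group_Gk group_Gk comp Gk_gen_closed u(1)])
    also have "\<dots> = g" unfolding u(2) by (rule G.word_val_cong[OF u(1)]) (simp add: \<Psi>_gen)
    finally show ?thesis by simp
  qed
  have \<Phi>_\<Psi>0: "\<Phi> (\<Psi>0 x) = (x, 0)" if x: "x \<in> carrier ?F" for x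
  proof -
    obtain u where u: "u \<in> gwords X" "x = pres_class X {} u"
      using x by (auto simp: carrier_presented_group)
    have emb: "(\<lambda>x. (x, 0)) \<in> hom ?F ?K" by (auto simp: hom_def)
    have cF: "?c \<in> X \<rightarrow> carrier ?F" using c by auto
    have "\<Phi> (\<Psi>0 x) = word_val ?K (\<lambda>i. \<Phi> (Gk_gen k w (A i))) u"
      unfolding u(2) \<Psi>0(2)[OF u(1)] by (rule hom_word_val[OF group_Gk K.is_group \<Phi> gA u(1)])
    also have "\<dots> = word_val ?K (\<lambda>i. (?c i, 0)) u"
      by (rule K.word_val_cong[OF u(1)]) (simp add: gen A_in_gens f_def)
    also have "\<dots> = (word_val ?F ?c u, 0)"
      using hom_word_val[OF F.is_group K.is_group emb cF u(1)] by simp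
    also have "word_val ?F ?c u = x" using u by (simp add: word_val_presented_group)
    finally show ?thesis .
  qed
  \<comment> \<open>In \<open>integer_group\<close> every \<open>n\<close> is the
    \<open>n\<close>-th power of 1, so the value at \<open>t\<close> determines the value at each
    power.\<close>
  have \<Phi>_pow: "\<Phi> (t [^]\<^bsub>Gk k w\<^esub> n) = (\<one>\<^bsub>?F\<^esub>, n)" for n :: int
  proof -
    have "(\<lambda>n. (\<one>\<^bsub>?F\<^esub>, n)) \<in> hom integer_group ?K" by (auto simp: hom_def)
    then interpret e: group_hom integer_group ?K "\<lambda>n. (\<one>\<^bsub>?F\<^esub>, n)"
      by unfold_locales
    show ?thesis
      using e.hom_int_pow[of 1 n] t_closed by (simp add: \<Phi>.hom_int_pow gen T_in_gens f_def)
  qed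
  have right: "\<Phi> (\<Psi> p) = p" if p: "p \<in> carrier ?K" for p
    using p t_closed by (auto simp: \<Psi>_def \<Phi>_\<Psi>0 \<Phi>_pow)
  have "bij_betw \<Phi> (carrier (Gk k w)) (carrier ?K)"
    by (rule bij_betw_byWitness[where f' = \<Psi>])
      (use left right hom_carrier[OF \<Phi>] hom_carrier[OF \<Psi>] in blast)+
  then have "\<Phi> \<in> iso (Gk k w) ?K" using \<Phi> by (simp add: iso_def)
  moreover have "\<forall>i\<in>X. \<Phi> (Gk_gen k w (A i)) = (?c i, 0)" "\<Phi> t = (\<one>\<^bsub>?F\<^esub>, 1)"
    by (auto simp: gen A_in_gens T_in_gens f_def)
  ultimately show ?thesis unfolding X_def by blast
qed

end

theorem theorem1p4:
  fixes k :: nat and w :: "nat \<Rightarrow> nat list"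
  assumes "k \<ge> 1"
    and "\<forall>i\<in>{1..k}. set (w i) \<subseteq> {1..<i}"
  shows "(separable_subgroup (Gk k w) (Hk k w) \<longleftrightarrow> (\<forall>i\<in>{1..k}. w i = [])) \<and>
    (residually_finite (Gammak k w) \<longrightarrow>
      (\<forall>i\<in>{1..k}. w i = []) \<and>
      (\<exists>\<phi> \<in> iso (Gk k w) (free_group {1..k} \<times>\<times> integer_group).
        (\<forall>i\<in>{1..k}. \<phi> (Gk_gen k w (A i)) = (pres_class {1..k} {} [Pos i], 0)) \<and>
        \<phi> (Gk_gen k w T) = (\<one>\<^bsub>free_group {1..k}\<^esub>, 1)))"
proof -
  interpret triangular_words k w by unfold_locales (rule assms(2))
  have iff: "separable_subgroup (Gk k w) (Hk k w) \<longleftrightarrow> (\<forall>i\<in>{1..k}. w i = [])"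
  proof
    assume "\<forall>i\<in>{1..k}. w i = []"
    then interpret trivial_words k w by unfold_locales
    show "separable_subgroup (Gk k w) (Hk k w)" by (rule separable_Hk)
  qed (rule separable_Hk_imp_trivial)
  \<comment> \<open>Residual finiteness yields separability of \<open>Hk k w\<close>, to which the
    equivalence applies.\<close>
  have triv: "\<forall>i\<in>{1..k}. w i = []" if "residually_finite (Gammak k w)"
    using residually_finite_hnn_imp_separable[OF group_Gk subgroup_Hk] that iff
    by (simp add: Gammak_def)
  show ?thesis
  proof (intro conjI impI iff triv)
    assume "residually_finite (Gammak k w)"
    then interpret trivial_words k w by unfold_locales (rule triv)
    show "\<exists>\<phi> \<in> iso (Gk k w) (free_group {1..k} \<times>\<times> integer_group).
        (\<forall>i\<in>{1..k}. \<phi> (Gk_gen k w (A i)) = (pres_class {1..k} {} [Pos i], 0)) \<and>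
        \<phi> (Gk_gen k w T) = (\<one>\<^bsub>free_group {1..k}\<^esub>, 1)"
      by (rule iso_free_times_integers)
  qed
qed

end
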